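(* Let $c_1,c_2$ be constants such that for every $k\in\mathbb N$ and every finite graph $H$: if $H$ has average degree at least $c_1k\sqrt{\log k}$ then $K^k$ is a minor of $H$, and if $H$ has average degree at least $c_2k^2$ then $H$ contains a subdivision of $K^k$. Let $k\in\mathbb N$ and let $G$ be a graph with $|\Omega(G)|\leq\aleph_0$. (a) If $\delta^{V,\Omega}(G)\geq c_1k\sqrt{\log k}+k$, then $K^k\preceq G$. (b) If $\delta^{V,\Omega}(G)\geq c_2k^2+k$, then $K^k\preceq_{top}G$.
   Context: Graphs are simple and may be infinite. For a finite graph $H$, $H\preceq G$ means $H$ is a minor of some finite subgraph of $G$, and $H\preceq_{top} G$ means $H$ is a topological minor of some finite subgraph of $G$ (i.e. $G$ contains a subdivision of $H$). A ray is a one-way infinite path. A set $S$ of vertices separates two rays $R_1,R_2$ if $V(R_1)\setminus S$ and $V(R_2)\setminus S$ lie in different components of $G-S$; two rays are equivalent if no finite vertex set separates them, and the ends of $G$ are the equivalence classes; $\Omega(G)$ is the set of ends. A vertex $v$ dominates a ray $R$ if there are infinitely many $v$–$V(R)$ paths pairwise disjoint except in $v$; $v$ dominates an end $\omega$ if it dominates some ray of $\omega$; $Dom(\omega)$ is the set of vertices dominating $\omega$. For $V'\subseteq V(G)$ and a set $\Omega'$ of ends, a $V'$–$\Omega'$ separator is a set $S\subseteq V(G)$ with $V'\not\subseteq S$ such that no component of $G-S$ contains both a vertex of $V'$ and a ray of an end in $\Omega'$. For a subgraph $H$, $\partial_e H=E(H,G-H)$ and $\partial_v H$ is the set of vertices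 of $H$ with a neighbour in $G-H$. For an end $\omega$, an $\omega$-region is an induced connected subgraph containing a ray of $\omega$ with finite vertex-boundary. Write $(H_i)_{i\in\mathbb N}\to\omega$ if $(H_i)$ is an infinite sequence of distinct $\omega$-regions with $H_{i+1}\subseteq H_i-\partial_vH_i$ and $\partial_vH_{i+1}$ an inclusion-minimal $\partial_vH_i$–$\Omega(H_{i+1})$ separator for every $i$, where $\Omega(H_{i+1})$ denotes the ends of the ambient graph having a ray in $H_{i+1}$. Relative degree: with $G_\omega:=G-Dom(\omega)$, if $G_\omega$ contains no ray of $\omega$ or $|Dom(\omega)|\ge\aleph_0$ set $d_{e/v}(\omega):=|Dom(\omega)|$; otherwise, with $\hat\omega$ the unique end of $G_\omega$ containing rays of $\omega$, $d_{e/v}(\omega):=|Dom(\omega)|+\inf_{(\hat H_i)\to\hat\omega}\liminf_{i}|\partial_e\hat H_i|/|\partial_v\hat H_i|$, infimum over sequences in $G_\omega$ with boundaries taken in $G_\omega$. $\delta^{V,\Omega}(G)$ is the minimum over all vertex degrees and all relative degrees of ends of $G$. *)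

theory Defs
  imports Complex_Main "HOL-Library.Countable_Set" "HOL-Library.Extended_Real"
    "HOL-Library.Liminf_Limsup"
begin

section \<open>Simple graphs, possibly infinite\<close>

datatype 'a graph = Graph (verts: "'a set") (edges: "'a set set")

definition simple_graph :: "'a graph \<Rightarrow> bool" where
  "simple_graph G \<longleftrightarrow> (\<forall>e\<in>edges G. \<exists>u v. u \<in> verts G \<and> v \<in> verts G \<and> u \<noteq> v \<and> e = {u, v})"

definition subgraph :: "'a graph \<Rightarrow> 'a graph \<Rightarrow> bool" where
  "subgraph H G \<longleftrightarrow> simple_graph H \<and> verts H \<subseteq> verts G \<and> edges H \<subseteq> edges G"

definition induced :: "'a graph \<Rightarrow> 'a set \<Rightarrow> 'a graph" where
  "induced G A = Graph (verts G \<inter> A) {e \<in> edges G. e \<subseteq> A}"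

definition del_verts :: "'a graph \<Rightarrow> 'a set \<Rightarrow> 'a graph" where
  "del_verts G S = induced G (verts G - S)"

definition complete_graph :: "nat \<Rightarrow> nat graph" where
  "complete_graph k = Graph {..<k} {{u, v} | u v. u < k \<and> v < k \<and> u \<noteq> v}"

definition nbrs :: "'a graph \<Rightarrow> 'a \<Rightarrow> 'a set" where
  "nbrs G v = {w \<in> verts G. {v, w} \<in> edges G}"

text \<open>Infinite cardinals are all identified with \<open>\<infinity>\<close>; sizes are only ever compared with real numbers.\<close>

definition ecard :: "'b set \<Rightarrow> ereal" where
  "ecard A = (if finite A then ereal (real (card A)) else \<infinity>)"

definition deg :: "'a graph \<Rightarrow> 'a \<Rightarrow> ereal" where
  "deg G v = ecard (nbrs G v)"

text \<open>Only meaningful for finite graphs with at least one vertex.\<close>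

definition avg_degree :: "'a graph \<Rightarrow> real" where
  "avg_degree G = (\<Sum>v\<in>verts G. real (card (nbrs G v))) / real (card (verts G))"

section \<open>Paths and components\<close>

definition is_path :: "'a graph \<Rightarrow> 'a list \<Rightarrow> bool" where
  "is_path G p \<longleftrightarrow> p \<noteq> [] \<and> distinct p \<and> set p \<subseteq> verts G
     \<and> successively (\<lambda>x y. {x, y} \<in> edges G) p"

definition path_edges :: "'a list \<Rightarrow> 'a set set" where
  "path_edges p = {{p ! i, p ! Suc i} | i. Suc i < length p}"

definition inner_verts :: "'a list \<Rightarrow> 'a set" where
  "inner_verts p = set p - {hd p, last p}"

definition connected_graph :: "'a graph \<Rightarrow> bool" where
  "connected_graph G \<longleftrightarrow> verts G \<noteq> {}
     \<and> (\<forall>u\<in>verts G. \<forall>v\<in>verts G. \<exists>p. is_path G p \<and> hd p = u \<and> last p = v)"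

definition is_component :: "'a graph \<Rightarrow> 'a graph \<Rightarrow> bool" where
  "is_component C G \<longleftrightarrow> subgraph C G \<and> connected_graph C
     \<and> (\<forall>C'. subgraph C' G \<and> connected_graph C' \<and> subgraph C C' \<longrightarrow> C' = C)"

section \<open>Minors and topological minors\<close>

text \<open>A minor is given by its branch sets \<open>B x\<close>.\<close>

definition is_minor :: "'b graph \<Rightarrow> 'a graph \<Rightarrow> bool" where
  "is_minor H G \<longleftrightarrow> (\<exists>B.
      (\<forall>x\<in>verts H. B x \<subseteq> verts G \<and> connected_graph (induced G (B x)))
    \<and> (\<forall>x\<in>verts H. \<forall>y\<in>verts H. x \<noteq> y \<longrightarrow> B x \<inter> B y = {})
    \<and> (\<forall>x y. {x, y} \<in> edges H \<longrightarrow> (\<exists>u\<in>B x. \<exists>v\<in>B y. {u, v} \<in> edges G)))"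

text \<open>\<open>f\<close> gives the branch vertices and \<open>P e\<close> the path that replaces the edge \<open>e\<close>.\<close>

definition is_subdivision :: "'a graph \<Rightarrow> 'b graph \<Rightarrow> bool" where
  "is_subdivision X H \<longleftrightarrow> (\<exists>f P.
      inj_on f (verts H)
    \<and> (\<forall>e\<in>edges H. is_path X (P e) \<and> {hd (P e), last (P e)} = f ` e
          \<and> inner_verts (P e) \<inter> f ` verts H = {})
    \<and> (\<forall>e\<in>edges H. \<forall>e'\<in>edges H. e \<noteq> e' \<longrightarrow> inner_verts (P e) \<inter> inner_verts (P e') = {})
    \<and> verts X = f ` verts H \<union> (\<Union>e\<in>edges H. set (P e))
    \<and> edges X = (\<Union>e\<in>edges H. path_edges (P e)))"

definition is_top_minor :: "'b graph \<Rightarrow> 'a graph \<Rightarrow> bool" where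
  "is_top_minor H G \<longleftrightarrow> (\<exists>X. subgraph X G \<and> is_subdivision X H)"

definition minor_le :: "'b graph \<Rightarrow> 'a graph \<Rightarrow> bool" where
  "minor_le H G \<longleftrightarrow> (\<exists>F. subgraph F G \<and> finite (verts F) \<and> is_minor H F)"

definition top_minor_le :: "'b graph \<Rightarrow> 'a graph \<Rightarrow> bool" where
  "top_minor_le H G \<longleftrightarrow> (\<exists>F. subgraph F G \<and> finite (verts F) \<and> is_top_minor H F)"

section \<open>Rays and ends\<close>

text \<open>A ray, as a subgraph, has a unique vertex of degree one, so it corresponds to exactly one
  such enumeration of its vertices.\<close>

definition is_ray :: "'a graph \<Rightarrow> (nat \<Rightarrow> 'a) \<Rightarrow> bool" where
  "is_ray G r \<longleftrightarrow> inj r \<and> range r \<subseteq> verts G \<and> (\<forall>i. {r i, r (Suc i)} \<in> edges G)"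

definition separates_rays :: "'a graph \<Rightarrow> 'a set \<Rightarrow> (nat \<Rightarrow> 'a) \<Rightarrow> (nat \<Rightarrow> 'a) \<Rightarrow> bool" where
  "separates_rays G S r s \<longleftrightarrow> (\<exists>C D. is_component C (del_verts G S)
     \<and> is_component D (del_verts G S) \<and> C \<noteq> D
     \<and> range r - S \<subseteq> verts C \<and> range s - S \<subseteq> verts D)"

definition ray_equiv :: "'a graph \<Rightarrow> ((nat \<Rightarrow> 'a) \<times> (nat \<Rightarrow> 'a)) set" where
  "ray_equiv G = {(r, s). is_ray G r \<and> is_ray G s
     \<and> \<not> (\<exists>S. finite S \<and> S \<subseteq> verts G \<and> separates_rays G S r s)}"

definition ends :: "'a graph \<Rightarrow> (nat \<Rightarrow> 'a) set set" where
  "ends G = {r. is_ray G r} // ray_equiv G"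

definition contains_ray_of :: "'a graph \<Rightarrow> (nat \<Rightarrow> 'a) set \<Rightarrow> bool" where
  "contains_ray_of H \<omega> \<longleftrightarrow> (\<exists>r\<in>\<omega>. is_ray H r)"

definition ends_in :: "'a graph \<Rightarrow> 'a graph \<Rightarrow> (nat \<Rightarrow> 'a) set set" where
  "ends_in G H = {\<omega> \<in> ends G. contains_ray_of H \<omega>}"

text \<open>A \<open>v\<close>--\<open>V(r)\<close> path meets \<open>V(r)\<close> in its last vertex only. Hence no vertex of \<open>r\<close> dominates
  \<open>r\<close> itself, but it may dominate a tail of \<open>r\<close>, which belongs to the same end.\<close>

definition dominates_ray :: "'a graph \<Rightarrow> 'a \<Rightarrow> (nat \<Rightarrow> 'a) \<Rightarrow> bool" where
  "dominates_ray G v r \<longleftrightarrow> (\<exists>PP. infinite PP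
     \<and> (\<forall>p\<in>PP. is_path G p \<and> hd p = v \<and> set p \<inter> range r = {last p})
     \<and> (\<forall>p\<in>PP. \<forall>q\<in>PP. p \<noteq> q \<longrightarrow> set p \<inter> set q = {v}))"

definition Dom :: "'a graph \<Rightarrow> (nat \<Rightarrow> 'a) set \<Rightarrow> 'a set" where
  "Dom G \<omega> = {v \<in> verts G. \<exists>r\<in>\<omega>. dominates_ray G v r}"

section \<open>Boundaries, regions and relative degree\<close>

definition edge_boundary :: "'a graph \<Rightarrow> 'a graph \<Rightarrow> 'a set set" where
  "edge_boundary G H = {{u, v} | u v. u \<in> verts H \<and> v \<in> verts G - verts H \<and> {u, v} \<in> edges G}"

definition vert_boundary :: "'a graph \<Rightarrow> 'a graph \<Rightarrow> 'a set" where
  "vert_boundary G H = {u \<in> verts H. \<exists>v \<in> verts G - verts H. {u, v} \<in> edges G}"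

definition separator :: "'a graph \<Rightarrow> 'a set \<Rightarrow> (nat \<Rightarrow> 'a) set set \<Rightarrow> 'a set \<Rightarrow> bool" where
  "separator G V' \<Omega>' S \<longleftrightarrow> S \<subseteq> verts G \<and> \<not> V' \<subseteq> S
     \<and> \<not> (\<exists>C. is_component C (del_verts G S) \<and> verts C \<inter> V' \<noteq> {}
            \<and> (\<exists>\<omega>\<in>\<Omega>'. contains_ray_of C \<omega>))"

definition minimal_separator ::
    "'a graph \<Rightarrow> 'a set \<Rightarrow> (nat \<Rightarrow> 'a) set set \<Rightarrow> 'a set \<Rightarrow> bool" where
  "minimal_separator G V' \<Omega>' S \<longleftrightarrow> separator G V' \<Omega>' S \<and> (\<forall>T. T \<subset> S \<longrightarrow> \<not> separator G V' \<Omega>' T)"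

definition is_region :: "'a graph \<Rightarrow> (nat \<Rightarrow> 'a) set \<Rightarrow> 'a graph \<Rightarrow> bool" where
  "is_region G \<omega> H \<longleftrightarrow> subgraph H G \<and> H = induced G (verts H) \<and> connected_graph H
     \<and> contains_ray_of H \<omega> \<and> finite (vert_boundary G H)"

definition regions_to :: "'a graph \<Rightarrow> (nat \<Rightarrow> 'a graph) \<Rightarrow> (nat \<Rightarrow> 'a) set \<Rightarrow> bool" where
  "regions_to G H \<omega> \<longleftrightarrow> inj H \<and> (\<forall>i. is_region G \<omega> (H i)
     \<and> subgraph (H (Suc i)) (del_verts (H i) (vert_boundary G (H i)))
     \<and> minimal_separator G (vert_boundary G (H i)) (ends_in G (H (Suc i)))
          (vert_boundary G (H (Suc i))))"

text \<open>The quotient below is never \<open>0 / 0\<close>: a separator exists only for a nonempty \<open>V'\<close>, so the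
  regions in a convergent sequence have nonempty boundaries.\<close>

definition rel_degree :: "'a graph \<Rightarrow> (nat \<Rightarrow> 'a) set \<Rightarrow> ereal" where
  "rel_degree G \<omega> = (let D = Dom G \<omega>; G' = del_verts G D in
     if \<not> contains_ray_of G' \<omega> \<or> infinite D then ecard D
     else (let \<omega>' = (THE \<omega>'. \<omega>' \<in> ends G' \<and> \<omega>' \<inter> \<omega> \<noteq> {}) in
       ecard D + (INF H \<in> {H. regions_to G' H \<omega>'}.
         liminf (\<lambda>i. ecard (edge_boundary G' (H i)) / ecard (vert_boundary G' (H i))))))"

definition min_degree_VE :: "'a graph \<Rightarrow> ereal" where
  "min_degree_VE G = Inf (deg G ` verts G \<union> rel_degree G ` ends G)"

end

theory Submission imports Defs begin

text \<open>If at least \<open>k\<close> vertices dominate some end, any two of them can be linked around every finite set,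
  so \<open>K\<^sup>k\<close> has a subdivision. Otherwise every end \<open>\<omega>\<close>, once its fewer than \<open>k\<close> dominating
  vertices are deleted, has arbitrarily remote regions with more than \<open>m\<close> boundary edges per boundary
  vertex, where \<open>m\<close> is the average degree to be forced. Going through the countably many ends, choose
  pairwise disjoint such regions \<open>H\<^sub>n\<close> that capture all ends, each one avoiding finite sets of neighbours
  reserved for the dominating vertices met so far.

  Let \<open>U\<close> be the graph without the interiors of the \<open>H\<^sub>n\<close>, divided into the vertex boundaries of the
  \<open>H\<^sub>n\<close> and singletons. Each of these blocks \<open>b\<close> sends at least \<open>m |b|\<close> edges to a finite subset of
  \<open>U\<close>. Following these finitely many edges from a vertex, and moving through finite connected parts of the
  \<open>H\<^sub>n\<close> inside a block, we cannot get infinitely far: by Koenig's lemma there would be a ray, but its end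
  is captured by some \<open>H\<^sub>n\<close>, of which the ray sees only a finite part. So there is a finite union of blocks
  that is closed under these moves, and it induces a subgraph of average degree at least \<open>m\<close>.\<close>

subsection \<open>Connectivity inside a vertex set\<close>

text \<open>The summand \<open>k\<close> in the bounds pays for dominating vertices: when no end has
  \<open>k\<close> of them, deleting those of one end costs its relative degree less than
  \<open>k\<close>, so boundary ratios still exceed \<open>m\<close>. Two obstacles shape the rest.
  A ratio controls only the mean number of edges leaving a boundary, and a single boundary vertex
  may have few neighbours outside; so a boundary must be taken as a whole. It need not be connected
  in \<open>U\<close>, hence the finite connected parts of the regions, which turn jumps inside a
  block into walks of \<open>G\<close> and Koenig's sequence into a ray of \<open>G\<close>. The
  other obstacle is that a dominating vertex may send nearly all its edges into interiors of
  regions. A vertex of \<open>D i\<close> therefore gets \<open>M\<close> times one plus the sizes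
  of all earlier boundaries as reserved neighbours: enough for it as a singleton and for any earlier
  boundary containing it. Region \<open>i\<close> and all later ones avoid \<open>D i\<close>, so no
  other block contains it. Countability of the ends means that each step has only finitely many
  finite sets to avoid.\<close>

lemma simple_graph_edgeD:
  assumes "simple_graph G" "{u, v} \<in> edges G"
  shows "u \<in> verts G" "v \<in> verts G" "u \<noteq> v"
  using assms unfolding simple_graph_def by (metis doubleton_eq_iff)+

lemma simple_graph_edge_cases:
  assumes "simple_graph G" "e \<in> edges G"
  obtains u v where "u \<in> verts G" "v \<in> verts G" "u \<noteq> v" "e = {u, v}"
  using assms unfolding simple_graph_def by blast

lemma verts_induced [simp]: "verts (induced G A) = verts G \<inter> A"
  by (simp add: induced_def)

lemma edges_induced [simp]: "edges (induced G A) = {e \<in> edges G. e \<subseteq> A}"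
  by (simp add: induced_def)

lemma verts_del_verts [simp]: "verts (del_verts G S) = verts G - S"
  by (auto simp: del_verts_def)

lemma edges_del_verts [simp]: "edges (del_verts G S) = {e \<in> edges G. e \<subseteq> verts G - S}"
  by (simp add: del_verts_def)

lemma simple_graph_induced: "simple_graph G \<Longrightarrow> simple_graph (induced G A)"
  unfolding simple_graph_def by (fastforce simp: induced_def)

lemma simple_graph_del_verts: "simple_graph G \<Longrightarrow> simple_graph (del_verts G S)"
  by (simp add: del_verts_def simple_graph_induced)

lemma subgraph_induced: "simple_graph G \<Longrightarrow> subgraph (induced G A) G"
  by (auto simp: subgraph_def simple_graph_induced)

text \<open>Connectivity as a reflexive transitive closure, which suits induction better than path
  lists. The conjunct \<open>u \<in> A\<close> rules out the empty walk at a vertex outside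
  \<open>A\<close>.\<close>

definition joined :: "'a graph \<Rightarrow> 'a set \<Rightarrow> 'a \<Rightarrow> 'a \<Rightarrow> bool" where
  "joined G A u v \<longleftrightarrow> u \<in> A \<and> (\<lambda>x y. {x, y} \<in> edges G \<and> x \<in> A \<and> y \<in> A)\<^sup>*\<^sup>* u v"

lemma joined_refl: "u \<in> A \<Longrightarrow> joined G A u u"
  by (simp add: joined_def)

lemma joined_step: "joined G A u v \<Longrightarrow> {v, w} \<in> edges G \<Longrightarrow> w \<in> A \<Longrightarrow> joined G A u w"
  unfolding joined_def
  by (auto elim: rtranclp.cases intro: rtranclp.rtrancl_into_rtrancl)

lemma joined_edge: "{u, v} \<in> edges G \<Longrightarrow> u \<in> A \<Longrightarrow> v \<in> A \<Longrightarrow> joined G A u v"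
  by (meson joined_refl joined_step)

lemma joined_trans: "joined G A u v \<Longrightarrow> joined G A v w \<Longrightarrow> joined G A u w"
  unfolding joined_def by auto

lemma joined_sym:
  assumes "joined G A u v" shows "joined G A v u"
proof -
  have "(\<lambda>x y. {x, y} \<in> edges G \<and> x \<in> A \<and> y \<in> A)\<^sup>*\<^sup>* u v" "u \<in> A"
    using assms by (auto simp: joined_def)
  then show ?thesis
  proof (induction rule: rtranclp_induct)
    case base then show ?case by (rule joined_refl)
  next
    case (step y z)
    then have "joined G A z y" by (intro joined_edge) (auto simp: insert_commute)
    with step show ?case by (blast intro: joined_trans)
  qed
qed

text \<open>Invariant principle for walks, the tool behind most trapping arguments below: a
  connected set that meets \<open>K\<close> and cannot leave it lies in \<open>K\<close>.\<close>

lemma joined_closed: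
  assumes "joined G A u v" "u \<in> K"
    and "\<And>x y. x \<in> K \<Longrightarrow> x \<in> A \<Longrightarrow> y \<in> A \<Longrightarrow> {x, y} \<in> edges G \<Longrightarrow> y \<in> K"
  shows "v \<in> K"
proof -
  have "(\<lambda>x y. {x, y} \<in> edges G \<and> x \<in> A \<and> y \<in> A)\<^sup>*\<^sup>* u v" using assms by (auto simp: joined_def)
  then show ?thesis by (induction rule: rtranclp_induct) (use assms in auto)
qed

lemma joined_in: "joined G A u v \<Longrightarrow> u \<in> A \<and> v \<in> A"
  using joined_closed[of G A u v A] by (auto simp: joined_def)

lemma joined_mono_graph:
  assumes "joined G A u v" "A \<subseteq> B"
    and "\<And>x y. {x, y} \<in> edges G \<Longrightarrow> x \<in> A \<Longrightarrow> y \<in> A \<Longrightarrow> {x, y} \<in> edges G'"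
  shows "joined G' B u v"
proof -
  have "(\<lambda>x y. {x, y} \<in> edges G \<and> x \<in> A \<and> y \<in> A)\<^sup>*\<^sup>* u v" "u \<in> A"
    using assms by (auto simp: joined_def)
  then show ?thesis
    by (induction rule: rtranclp_induct) (use assms in \<open>auto intro: joined_refl joined_step\<close>)
qed

lemma joined_mono: "joined G A u v \<Longrightarrow> A \<subseteq> B \<Longrightarrow> joined G B u v"
  by (rule joined_mono_graph)

lemma joined_class:
  assumes "joined G A u v" shows "joined G {w. joined G A u w} u v"
proof -
  have "(\<lambda>x y. {x, y} \<in> edges G \<and> x \<in> A \<and> y \<in> A)\<^sup>*\<^sup>* u v" "u \<in> A"
    using assms by (auto simp: joined_def)
  then show ?thesis
  proof (induction rule: rtranclp_induct)
    case base then show ?case by (auto intro!: joined_refl)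
  next
    case (step y z)
    have "joined G A u y" using joined_in[OF step.IH[OF step.prems]] by simp
    then have "joined G A u z" using step.hyps joined_step[of G A u y z] by simp
    then show ?case using joined_step[OF step.IH[OF step.prems], of z] step.hyps by simp
  qed
qed

lemma is_path_induced: "is_path (induced G A) p \<longleftrightarrow> is_path G p \<and> set p \<subseteq> A"
proof
  assume p: "is_path G p \<and> set p \<subseteq> A"
  then have "successively (\<lambda>x y. {x, y} \<in> edges G) p" by (simp add: is_path_def)
  then have "successively (\<lambda>x y. {x, y} \<in> edges (induced G A)) p"
    by (rule successively_mono) (use p in auto)
  with p show "is_path (induced G A) p" by (auto simp: is_path_def)
next
  assume p: "is_path (induced G A) p"
  then have "successively (\<lambda>x y. {x, y} \<in> edges (induced G A)) p" by (simp add: is_path_def)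
  then have "successively (\<lambda>x y. {x, y} \<in> edges G) p"
    by (rule successively_mono) auto
  with p show "is_path G p \<and> set p \<subseteq> A" by (auto simp: is_path_def)
qed

lemma is_path_mono:
  assumes "is_path G p" "verts G \<subseteq> verts G'" "edges G \<subseteq> edges G'" shows "is_path G' p"
proof -
  have "successively (\<lambda>x y. {x, y} \<in> edges G) p" using assms by (simp add: is_path_def)
  then have "successively (\<lambda>x y. {x, y} \<in> edges G') p"
    by (rule successively_mono) (use assms in auto)
  then show ?thesis using assms by (auto simp: is_path_def)
qed

lemma is_path_Cons:
  "is_path G (x # p) \<longleftrightarrow> x \<in> verts G \<and> x \<notin> set p \<and> (p = [] \<or> is_path G p \<and> {x, hd p} \<in> edges G)"
  by (cases p) (auto simp: is_path_def)

lemma joined_hd_path: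
  assumes "is_path G p" "v \<in> set p" shows "joined G (set p) (hd p) v"
  using assms
proof (induction p arbitrary: v)
  case Nil then show ?case by simp
next
  case (Cons x p)
  show ?case
  proof (cases "v = x")
    case True then show ?thesis by (simp add: joined_refl)
  next
    case False
    then have p: "v \<in> set p" "is_path G p" "{x, hd p} \<in> edges G"
      using Cons.prems by (auto simp: is_path_Cons)
    have "joined G (set (x # p)) (hd p) v"
      using Cons.IH[OF p(2) p(1)] by (rule joined_mono) auto
    moreover have "joined G (set (x # p)) x (hd p)"
      using p by (intro joined_edge) (auto simp: is_path_def)
    ultimately show ?thesis by (auto intro: joined_trans)
  qed
qed

lemma joined_hd_last: "is_path G p \<Longrightarrow> joined G (set p) (hd p) (last p)"
  by (rule joined_hd_path) (auto simp: is_path_def)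

lemma is_path_append1:
  "is_path G (p @ q) \<Longrightarrow> p \<noteq> [] \<Longrightarrow> is_path G p"
  by (auto simp: is_path_def successively_append_iff)

lemma is_path_snoc:
  assumes "is_path G p" "{last p, x} \<in> edges G" "x \<in> verts G" "x \<notin> set p"
  shows "is_path G (p @ [x])"
  using assms by (auto simp: is_path_def successively_append_iff)

lemma path_of_joined:
  assumes "joined G A u v" "A \<subseteq> verts G"
  shows "\<exists>p. is_path G p \<and> set p \<subseteq> A \<and> hd p = u \<and> last p = v"
proof -
  have "(\<lambda>x y. {x, y} \<in> edges G \<and> x \<in> A \<and> y \<in> A)\<^sup>*\<^sup>* u v" "u \<in> A"
    using assms by (auto simp: joined_def)
  then show ?thesis
  proof (induction rule: rtranclp_induct)
    case base
    then show ?case using assms(2) by (intro exI[of _ "[u]"]) (auto simp: is_path_def)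
  next
    case (step y z)
    then obtain p where p: "is_path G p" "set p \<subseteq> A" "hd p = u" "last p = y" by auto
    then have "p \<noteq> []" by (auto simp: is_path_def)
    show ?case
    \<comment> \<open>A walk that returns to its path is cut back at the repeated vertex, so the
      list stays distinct.\<close>
    proof (cases "z \<in> set p")
      case True
      then obtain p1 p2 where "p = p1 @ z # p2" by (meson split_list)
      then have "is_path G ((p1 @ [z]) @ p2)" using p by simp
      then have "is_path G (p1 @ [z])" by (rule is_path_append1) simp
      moreover have "hd (p1 @ [z]) = u" using p(3) \<open>p = _\<close> by (cases p1) auto
      ultimately show ?thesis using p(2) \<open>p = _\<close> by (intro exI[of _ "p1 @ [z]"]) auto
    next
      case False
      have "is_path G (p @ [z])"
        using p step False assms(2) by (intro is_path_snoc) auto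
      then show ?thesis using p \<open>p \<noteq> []\<close> step by (intro exI[of _ "p @ [z]"]) auto
    qed
  qed
qed

lemma connected_induced_iff:
  assumes "A \<subseteq> verts G"
  shows "connected_graph (induced G A) \<longleftrightarrow> A \<noteq> {} \<and> (\<forall>u\<in>A. \<forall>v\<in>A. joined G A u v)"
proof -
  have "(\<exists>p. is_path (induced G A) p \<and> hd p = u \<and> last p = v) \<longleftrightarrow> joined G A u v" for u v
  proof
    assume "\<exists>p. is_path (induced G A) p \<and> hd p = u \<and> last p = v"
    then obtain p where p: "is_path G p" "set p \<subseteq> A" "hd p = u" "last p = v"
      by (auto simp: is_path_induced)
    show "joined G A u v" using joined_mono[OF joined_hd_last[OF p(1)] p(2)] p(3,4) by simp
  next
    assume "joined G A u v"
    then show "\<exists>p. is_path (induced G A) p \<and> hd p = u \<and> last p = v"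
      unfolding is_path_induced using path_of_joined[OF _ assms] by blast
  qed
  then show ?thesis unfolding connected_graph_def using assms by (simp add: Int_absorb1)
qed

lemma connected_graph_joined:
  assumes "connected_graph C" "u \<in> verts C" "v \<in> verts C"
  shows "joined C (verts C) u v"
proof -
  obtain p where "is_path C p" "hd p = u" "last p = v"
    using assms unfolding connected_graph_def by blast
  moreover from this have "joined C (set p) u v" using joined_hd_last[of C p] by simp
  ultimately show ?thesis by (auto simp: is_path_def intro: joined_mono)
qed

text \<open>Translates maximal connected subgraphs into reachability classes. A connected subgraph
  through \<open>v\<close> has its vertices in the class of \<open>v\<close> and, being simple, its
  edges as well; hence the induced graph on the class is the only maximal one.\<close>

lemma is_component_del_iff:
  assumes G: "simple_graph G"
  shows "is_component C (del_verts G S) \<longleftrightarrow>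
    (\<exists>v\<in>verts G - S. C = induced G {u. joined G (verts G - S) v u})"
proof -
  let ?K = "\<lambda>v. {u. joined G (verts G - S) v u}"
  have Ksub: "?K v \<subseteq> verts G - S" for v using joined_in by fast
  have conn: "connected_graph (induced G (?K v))" if "v \<in> verts G - S" for v
  proof -
    have "?K v \<subseteq> verts G" using Ksub by fast
    moreover have "v \<in> ?K v" using that by (auto intro: joined_refl)
    moreover have "joined G (?K v) a b" if "a \<in> ?K v" "b \<in> ?K v" for a b
      using joined_class[of G "verts G - S" v a] joined_class[of G "verts G - S" v b] that
      by (metis joined_sym joined_trans mem_Collect_eq)
    ultimately show ?thesis by (subst connected_induced_iff) auto
  qed
  have sub: "subgraph (induced G (?K v)) (del_verts G S)" for v
    using Ksub[of v] G by (auto simp: subgraph_def simple_graph_induced)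
  have big: "verts C' \<subseteq> ?K v" if "subgraph C' (del_verts G S)" "connected_graph C'" "v \<in> verts C'" for C' v
  proof
    fix w assume "w \<in> verts C'"
    with that have "joined C' (verts C') v w" by (simp add: connected_graph_joined)
    then show "w \<in> ?K v"
      using that(1) by (auto intro!: joined_mono_graph[of C' "verts C'"] simp: subgraph_def)
  qed
  have edg: "edges C' \<subseteq> {e. e \<subseteq> verts C'}" if "subgraph C' (del_verts G S)" for C'
    using that unfolding subgraph_def simple_graph_def by auto
  have le: "subgraph C' (induced G (?K v))"
    if "subgraph C' (del_verts G S)" "connected_graph C'" "v \<in> verts C'" for C' v
  proof -
    have "simple_graph C'" "verts C' \<subseteq> verts G" "edges C' \<subseteq> edges G"
      using that(1) by (auto simp: subgraph_def)
    moreover have "e \<subseteq> ?K v" if "e \<in> edges C'" for e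
      using edg[OF \<open>subgraph C' (del_verts G S)\<close>] big[OF \<open>subgraph C' (del_verts G S)\<close> _ \<open>v \<in> verts C'\<close>]
        \<open>connected_graph C'\<close> that by blast
    ultimately show ?thesis
      using big[OF that] unfolding subgraph_def verts_induced edges_induced by blast
  qed
  show ?thesis
  proof
    assume C: "is_component C (del_verts G S)"
    then obtain v where v: "v \<in> verts C" unfolding is_component_def connected_graph_def by blast
    then have "v \<in> verts G - S" using C by (auto simp: is_component_def subgraph_def)
    moreover have "subgraph C (induced G (?K v))" using le[OF _ _ v] C by (auto simp: is_component_def)
    then have "induced G (?K v) = C"
      using C sub[of v] conn[OF \<open>v \<in> verts G - S\<close>] unfolding is_component_def by blast
    ultimately show "\<exists>v\<in>verts G - S. C = induced G (?K v)" by blast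
  next
    assume "\<exists>v\<in>verts G - S. C = induced G (?K v)"
    then obtain v where v: "v \<in> verts G - S" "C = induced G (?K v)" by blast
    have "C' = C" if "subgraph C' (del_verts G S)" "connected_graph C'" "subgraph C C'" for C'
    proof -
      have "v \<in> verts C" using v by (auto intro: joined_refl)
      then have "subgraph C' C" using le[OF that(1,2), of v] that(3) v(2) unfolding subgraph_def by blast
      then show ?thesis using that(3) by (cases C; cases C') (auto simp: subgraph_def)
    qed
    then show "is_component C (del_verts G S)"
      using v sub[of v] conn[of v] unfolding is_component_def by blast
  qed
qed

subsection \<open>Rays and ends\<close>

text \<open>The component of \<open>G - X\<close> that contains a tail of the ray \<open>r\<close>; meaningful for finite \<open>X\<close>.\<close>

definition live :: "'a graph \<Rightarrow> 'a set \<Rightarrow> (nat \<Rightarrow> 'a) \<Rightarrow> 'a set" where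
  "live G X r = {u. \<exists>n. \<forall>i\<ge>n. joined G (verts G - X) u (r i)}"

definition ray_tail :: "nat \<Rightarrow> (nat \<Rightarrow> 'a) \<Rightarrow> nat \<Rightarrow> 'a" where
  "ray_tail n r i = r (n + i)"

lemma ray_avoids:
  assumes "is_ray G r" "finite X" shows "\<exists>n. \<forall>i\<ge>n. r i \<notin> X"
proof -
  have "finite (r -` X)" using assms by (auto simp: is_ray_def intro: finite_vimageI)
  then obtain n where "\<forall>i\<in>r -` X. i < n" by (auto simp: finite_nat_set_iff_bounded)
  then have "r i \<notin> X" if "i \<ge> n" for i using that leD by blast
  then show ?thesis by blast
qed

lemma ray_joined:
  assumes "is_ray G r" "\<And>l. i \<le> l \<Longrightarrow> l \<le> j \<Longrightarrow> r l \<in> A" "i \<le> j"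
  shows "joined G A (r i) (r j)"
  using assms(3,2)
proof (induction rule: dec_induct)
  case base then show ?case by (simp add: joined_refl)
next
  case (step n)
  then show ?case using assms(1) by (auto intro!: joined_step[of G A "r i" "r n"] simp: is_ray_def)
qed

lemma live_sub: "live G X r \<subseteq> verts G - X"
  unfolding live_def using joined_in by fast

lemma live_eq_class:
  assumes "is_ray G r" "\<And>l. l \<ge> n \<Longrightarrow> r l \<notin> X" "i \<ge> n"
  shows "live G X r = {u. joined G (verts G - X) (r i) u}"
proof -
  have V: "r l \<in> verts G - X" if "l \<ge> n" for l using assms that by (auto simp: is_ray_def)
  have j: "joined G (verts G - X) (r i) (r l)" if "l \<ge> i" for l
    using ray_joined[OF assms(1), of i l "verts G - X"] V that assms(3) by auto
  show ?thesis
  proof (intro equalityI subsetI)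
    fix u assume "u \<in> live G X r"
    then obtain n' where "\<forall>l\<ge>n'. joined G (verts G - X) u (r l)" by (auto simp: live_def)
    then have "joined G (verts G - X) u (r (max n' i))" by simp
    then show "u \<in> {u. joined G (verts G - X) (r i) u}"
      using j[of "max n' i"] by (auto intro: joined_trans joined_sym)
  next
    fix u assume "u \<in> {u. joined G (verts G - X) (r i) u}"
    then show "u \<in> live G X r"
      unfolding live_def using j by (blast intro: joined_trans joined_sym)
  qed
qed

lemma live_tail:
  assumes "is_ray G r" "finite X"
  shows "\<exists>n. \<forall>i\<ge>n. r i \<in> live G X r"
proof -
  obtain n where n: "\<forall>i\<ge>n. r i \<notin> X" using ray_avoids[OF assms(1,2)] by blast
  then have "r i \<in> live G X r" if "i \<ge> n" for i
    using live_eq_class[OF assms(1), of n X i] that assms(1)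
    by (auto intro!: joined_refl simp: is_ray_def)
  then show ?thesis by blast
qed

text \<open>Returning to \<open>K\<close> infinitely often is enough: some visit happens after the
  ray has left \<open>X\<close> for good, and from there the whole component is reached inside
  \<open>K\<close>.\<close>

lemma live_closed:
  assumes "is_ray G r" "finite X" "\<And>n. \<exists>i\<ge>n. r i \<in> K"
    and "\<And>x y. x \<in> K \<Longrightarrow> x \<in> verts G - X \<Longrightarrow> y \<in> verts G - X \<Longrightarrow> {x, y} \<in> edges G \<Longrightarrow> y \<in> K"
  shows "live G X r \<subseteq> K"
proof
  fix u assume u: "u \<in> live G X r"
  obtain n where n: "\<forall>i\<ge>n. r i \<notin> X" using ray_avoids[OF assms(1,2)] by blast
  obtain i where i: "i \<ge> n" "r i \<in> K" using assms(3) by blast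
  have "joined G (verts G - X) (r i) u"
    using u live_eq_class[OF assms(1), of n X i] n i by auto
  then show "u \<in> K" by (rule joined_closed) (use i(2) assms(4) in auto)
qed

lemma live_step:
  assumes "u \<in> live G X r" "{u, v} \<in> edges G" "v \<in> verts G - X"
  shows "v \<in> live G X r"
proof -
  have "joined G (verts G - X) v u"
    using assms joined_in[of G "verts G - X" u] by (auto simp: live_def insert_commute intro!: joined_edge)
  then show ?thesis using assms(1) unfolding live_def by (blast intro: joined_trans)
qed

lemma live_joined:
  assumes "u \<in> live G X r" "v \<in> live G X r" shows "joined G (verts G - X) u v"
proof -
  obtain n n' where "\<forall>i\<ge>n. joined G (verts G - X) u (r i)" "\<forall>i\<ge>n'. joined G (verts G - X) v (r i)"
    using assms by (auto simp: live_def)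
  then have "joined G (verts G - X) u (r (max n n'))" "joined G (verts G - X) v (r (max n n'))" by auto
  then show ?thesis by (blast intro: joined_trans joined_sym)
qed

lemma live_memI: "joined G (verts G - X) u v \<Longrightarrow> v \<in> live G X r \<Longrightarrow> u \<in> live G X r"
  unfolding live_def by (blast intro: joined_trans)

lemma live_eqI:
  assumes "u \<in> live G X r" "u \<in> live G X s" shows "live G X r = live G X s"
  using assms live_memI live_joined by (metis subsetI subset_antisym)

lemma live_mono: "X \<subseteq> Y \<Longrightarrow> live G Y r \<subseteq> live G X r"
  unfolding live_def using joined_mono[of G "verts G - Y" _ _ "verts G - X"] by blast

lemma live_component:
  assumes "simple_graph G" "is_ray G r" "finite X"
  shows "is_component (induced G (live G X r)) (del_verts G X)"
proof -
  obtain n where n: "\<forall>i\<ge>n. r i \<notin> X" using ray_avoids[OF assms(2,3)] by blast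
  then have "r n \<in> verts G - X" "live G X r = {u. joined G (verts G - X) (r n) u}"
    using live_eq_class[OF assms(2), of n X n] assms(2) by (auto simp: is_ray_def)
  then show ?thesis unfolding is_component_del_iff[OF assms(1)] by auto
qed

lemma live_joined_inside:
  assumes "is_ray G r" "finite X" "u \<in> live G X r" "v \<in> live G X r"
  shows "joined G (live G X r) u v"
proof -
  obtain n where "\<forall>i\<ge>n. r i \<notin> X" using ray_avoids[OF assms(1,2)] by blast
  then have e: "live G X r = {u. joined G (verts G - X) (r n) u}"
    using live_eq_class[OF assms(1), of n X n] by simp
  then show ?thesis using assms(3,4) joined_class[of G "verts G - X" "r n"]
    by (metis joined_sym joined_trans mem_Collect_eq)
qed

lemma component_eq_live:
  assumes "simple_graph G" "is_component C (del_verts G X)" "v \<in> verts C" "v \<in> live G X r"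
  shows "verts C = live G X r" "C = induced G (live G X r)"
proof -
  obtain w where w: "C = induced G {u. joined G (verts G - X) w u}"
    using assms by (auto simp: is_component_del_iff)
  then have wv: "joined G (verts G - X) w v" using assms(3) by auto
  have e: "{u. joined G (verts G - X) w u} = live G X r"
  proof (intro equalityI subsetI)
    fix x assume "x \<in> {u. joined G (verts G - X) w u}"
    then have "joined G (verts G - X) x v" using wv by (blast intro: joined_trans joined_sym)
    then show "x \<in> live G X r" using assms(4) by (rule live_memI)
  next
    fix x assume "x \<in> live G X r"
    then have "joined G (verts G - X) v x" using assms(4) by (simp add: live_joined)
    then show "x \<in> {u. joined G (verts G - X) w u}" using wv by (blast intro: joined_trans)
  qed
  show "C = induced G (live G X r)" using w e by simp
  then show "verts C = live G X r" using live_sub[of G X r] by auto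
qed

section \<open>Equivalence of rays in terms of \<open>live\<close>\<close>

lemma separates_rays_imp:
  assumes G: "simple_graph G" and r: "is_ray G r" and s: "is_ray G s" and X: "finite X"
    and sep: "separates_rays G X r s"
  shows "live G X r \<noteq> live G X s"
proof -
  obtain C D where CD: "is_component C (del_verts G X)" "is_component D (del_verts G X)" "C \<noteq> D"
    "range r - X \<subseteq> verts C" "range s - X \<subseteq> verts D"
    using sep by (auto simp: separates_rays_def)
  obtain i where i: "r i \<in> live G X r" using live_tail[OF r X] by blast
  obtain j where j: "s j \<in> live G X s" using live_tail[OF s X] by blast
  have "C = induced G (live G X r)"
    using component_eq_live(2)[OF G CD(1) _ i] CD(4) i live_sub[of G X r] by blast
  moreover have "D = induced G (live G X s)"
    using component_eq_live(2)[OF G CD(2) _ j] CD(5) j live_sub[of G X s] by blast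
  ultimately show ?thesis using CD(3) by auto
qed

text \<open>A separator must leave all of each remaining ray in one component, but initial segments
  may lie in other components of \<open>G - X\<close>. They are therefore added to the
  separator.\<close>

lemma separates_raysI:
  assumes G: "simple_graph G" and r: "is_ray G r" and s: "is_ray G s" and X: "finite X" "X \<subseteq> verts G"
    and ne: "live G X r \<noteq> live G X s"
  shows "\<exists>Y. finite Y \<and> Y \<subseteq> verts G \<and> separates_rays G Y r s"
proof -
  obtain n1 where n1: "\<forall>i\<ge>n1. r i \<in> live G X r" using live_tail r X by blast
  obtain n2 where n2: "\<forall>i\<ge>n2. s i \<in> live G X s" using live_tail s X by blast
  have disj: "live G X r \<inter> live G X s = {}" using ne live_eqI by (metis disjoint_iff)
  define n where "n = max n1 n2"
  obtain n3 where n3: "\<forall>i\<ge>n3. r i \<notin> s ` {..<n}" using ray_avoids[OF r, of "s ` {..<n}"] by auto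
  obtain n4 where n4: "\<forall>i\<ge>n4. s i \<notin> r ` {..<n}" using ray_avoids[OF s, of "r ` {..<n}"] by auto
  \<comment> \<open>From index \<open>n\<close> on the rays run in disjoint components, so a late
    vertex of one can only equal one of the first \<open>n\<close> vertices of the other. From
    \<open>N\<close> on this is excluded too, so enlarging \<open>X\<close> to \<open>Y\<close>
    leaves both tails intact.\<close>
  define N where "N = max n (max n3 n4)"
  define Y where "Y = X \<union> r ` {..<N} \<union> s ` {..<N}"
  have Y: "finite Y" "Y \<subseteq> verts G" "X \<subseteq> Y" using X r s by (auto simp: Y_def is_ray_def)
  have rl: "r i \<in> live G X r" "s i \<in> live G X s" if "i \<ge> n" for i
    using n1 n2 that by (auto simp: n_def)
  have ij: "r i \<noteq> s j" if "i \<ge> n" "j \<ge> n" for i j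
    using rl(1)[OF that(1)] rl(2)[OF that(2)] disj by auto
  have rY: "r i \<notin> Y" if "i \<ge> N" for i
  proof
    assume "r i \<in> Y"
    then consider "r i \<in> X" | j where "j < N" "r i = r j" | j where "j < N" "r i = s j"
      by (auto simp: Y_def)
    then show False
    proof cases
      case 1 then show False using rl(1)[of i] that live_sub[of G X r] by (auto simp: N_def)
    next
      case 2 then show False using r that by (auto simp: is_ray_def inj_eq)
    next
      case 3
      have "j < n" using ij[of i j] that 3(2) by (cases "j < n") (auto simp: N_def)
      then show False using n3 that 3(2) by (auto simp: N_def)
    qed
  qed
  have sY: "s i \<notin> Y" if "i \<ge> N" for i
  proof
    assume "s i \<in> Y"
    then consider "s i \<in> X" | j where "j < N" "s i = s j" | j where "j < N" "s i = r j"
      by (auto simp: Y_def)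
    then show False
    proof cases
      case 1 then show False using rl(2)[of i] that live_sub[of G X s] by (auto simp: N_def)
    next
      case 2 then show False using s that by (auto simp: is_ray_def inj_eq)
    next
      case 3
      have "j < n" using ij[of j i] that 3(2) by (cases "j < n") (auto simp: N_def)
      then show False using n4 that 3(2) by (auto simp: N_def)
    qed
  qed
  have rin: "r i \<in> live G Y r" if "i \<ge> N" for i
    using live_eq_class[OF r, of N Y i] rY that r by (auto intro!: joined_refl simp: is_ray_def)
  have sin: "s i \<in> live G Y s" if "i \<ge> N" for i
    using live_eq_class[OF s, of N Y i] sY that s by (auto intro!: joined_refl simp: is_ray_def)
  have "range r - Y \<subseteq> live G Y r"
  proof
    fix x assume "x \<in> range r - Y"
    then obtain i where "x = r i" "r i \<notin> Y" by auto
    then have "i \<ge> N" by (force simp: Y_def)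
    then show "x \<in> live G Y r" using rin \<open>x = r i\<close> by simp
  qed
  moreover have "range s - Y \<subseteq> live G Y s"
  proof
    fix x assume "x \<in> range s - Y"
    then obtain i where "x = s i" "s i \<notin> Y" by auto
    then have "i \<ge> N" by (force simp: Y_def)
    then show "x \<in> live G Y s" using sin \<open>x = s i\<close> by simp
  qed
  moreover have "live G Y r \<inter> live G Y s = {}"
    using disj live_mono[OF Y(3), of G r] live_mono[OF Y(3), of G s] by blast
  then have "induced G (live G Y r) \<noteq> induced G (live G Y s)"
  proof -
    have "r N \<in> verts (induced G (live G Y r))"
      using rin[of N] live_sub[of G Y r] by auto
    moreover have "r N \<notin> verts (induced G (live G Y s))"
      using rin[of N] \<open>live G Y r \<inter> live G Y s = {}\<close> by auto
    ultimately show ?thesis by metis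
  qed
  ultimately have "separates_rays G Y r s"
    unfolding separates_rays_def
    using live_component[OF G r Y(1)] live_component[OF G s Y(1)] live_sub[of G Y r] live_sub[of G Y s]
    by (intro exI[of _ "induced G (live G Y r)"] exI[of _ "induced G (live G Y s)"]) auto
  then show ?thesis using Y by blast
qed

text \<open>Equality of components for every finite \<open>X\<close> makes symmetry and transitivity
  of ray equivalence evident. Sets \<open>X\<close> with elements outside \<open>verts G\<close> are
  harmless, since only \<open>verts G - X\<close> enters \<open>live\<close>.\<close>

lemma ray_equiv_iff:
  assumes G: "simple_graph G"
  shows "(r, s) \<in> ray_equiv G \<longleftrightarrow> is_ray G r \<and> is_ray G s \<and> (\<forall>X. finite X \<longrightarrow> live G X r = live G X s)"
proof -
  have "live G X r = live G X s"
    if "is_ray G r" "is_ray G s" "finite X" "\<not> (\<exists>S. finite S \<and> S \<subseteq> verts G \<and> separates_rays G S r s)" for X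
  proof -
    have e: "live G X t = live G (X \<inter> verts G) t" for t
    proof -
      have "verts G - X \<inter> verts G = verts G - X" by auto
      then show ?thesis unfolding live_def by simp
    qed
    show ?thesis
      using separates_raysI[OF G that(1,2), of "X \<inter> verts G"] that(3,4) e[of r] e[of s] by auto
  qed
  moreover have "\<not> separates_rays G X r s"
    if "is_ray G r" "is_ray G s" "finite X" "\<forall>X. finite X \<longrightarrow> live G X r = live G X s" for X
    using separates_rays_imp[OF G that(1-3)] that(3,4) by blast
  ultimately show ?thesis unfolding ray_equiv_def by auto
qed

lemma ends_iff:
  assumes G: "simple_graph G"
  shows "\<omega> \<in> ends G \<longleftrightarrow>
    (\<exists>r. is_ray G r \<and> \<omega> = {s. is_ray G s \<and> (\<forall>X. finite X \<longrightarrow> live G X s = live G X r)})"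
  unfolding ends_def quotient_def Image_def by (auto simp: ray_equiv_iff[OF G])

lemma end_ray: "simple_graph G \<Longrightarrow> \<omega> \<in> ends G \<Longrightarrow> r \<in> \<omega> \<Longrightarrow> is_ray G r"
  by (auto simp: ends_iff)

lemma end_live: "simple_graph G \<Longrightarrow> \<omega> \<in> ends G \<Longrightarrow> r \<in> \<omega> \<Longrightarrow> s \<in> \<omega> \<Longrightarrow> finite X \<Longrightarrow> live G X r = live G X s"
  by (auto simp: ends_iff)

lemma end_nonempty: "simple_graph G \<Longrightarrow> \<omega> \<in> ends G \<Longrightarrow> \<exists>r. r \<in> \<omega>"
  by (auto simp: ends_iff)

lemma end_memI:
  assumes "simple_graph G" "\<omega> \<in> ends G" "r \<in> \<omega>" "is_ray G s"
    "\<And>X. finite X \<Longrightarrow> live G X s = live G X r"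
  shows "s \<in> \<omega>"
  using assms by (auto simp: ends_iff)

lemma ray_in_end:
  assumes "simple_graph G" "is_ray G r" shows "\<exists>\<omega>\<in>ends G. r \<in> \<omega>"
  using assms
  by (intro bexI[of _ "{s. is_ray G s \<and> (\<forall>X. finite X \<longrightarrow> live G X s = live G X r)}"])
    (auto simp: ends_iff)

lemma is_ray_tail: "is_ray G r \<Longrightarrow> is_ray G (ray_tail n r)"
  by (auto simp: is_ray_def ray_tail_def inj_eq intro!: injI)

lemma live_ray_tail:
  assumes r: "is_ray G r" and X: "finite X"
  shows "live G X (ray_tail n r) = live G X r"
proof -
  obtain a where a: "\<forall>i\<ge>a. r i \<in> live G X r" using live_tail[OF r X] by blast
  obtain b where b: "\<forall>i\<ge>b. ray_tail n r i \<in> live G X (ray_tail n r)"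
    using live_tail[OF is_ray_tail[OF r] X] by blast
  have "r (n + max a b) \<in> live G X r" "r (n + max a b) \<in> live G X (ray_tail n r)"
    using a b[rule_format, of "max a b"] by (auto simp: ray_tail_def)
  then show ?thesis by (metis live_eqI)
qed

lemma end_ray_tail:
  assumes "simple_graph G" "\<omega> \<in> ends G" "r \<in> \<omega>" shows "ray_tail n r \<in> \<omega>"
  using assms end_ray[OF assms] by (intro end_memI[OF assms]) (auto simp: is_ray_tail live_ray_tail)

subsection \<open>Dominating vertices\<close>

text \<open>A finite \<open>X\<close> meets only finitely many paths of the fan, because these share
  only \<open>v\<close>. The others end in infinitely many vertices of the ray, hence also beyond
  any given index.\<close>

lemma dominator_live:
  assumes r: "is_ray G r" and dom: "dominates_ray G v r" and X: "finite X" "v \<notin> X"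
  shows "v \<in> live G X r"
proof -
  obtain PP where PP: "infinite PP"
    and PP': "\<forall>p\<in>PP. is_path G p \<and> hd p = v \<and> set p \<inter> range r = {last p}"
      "\<forall>p\<in>PP. \<forall>q\<in>PP. p \<noteq> q \<longrightarrow> set p \<inter> set q = {v}"
    using dom unfolding dominates_ray_def by (elim exE conjE)
  have path: "is_path G p \<and> hd p = v \<and> set p \<inter> range r = {last p}" if "p \<in> PP" for p
    using PP'(1) that by (rule bspec)
  have disj: "set p \<inter> set q = {v}" if "p \<in> PP" "q \<in> PP" "p \<noteq> q" for p q
    using PP'(2) that by simp
  have hd: "v \<in> set p" if "p \<in> PP" for p using path[OF that] by (auto simp: is_path_def)
  \<comment> \<open>A path of the fan meets the ray only in its last vertex; if \<open>v\<close>
    were on the ray, every path would be \<open>[v]\<close> and the fan finite.\<close>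
  have vr: "v \<notin> range r"
  proof
    assume "v \<in> range r"
    have "p = [v]" if "p \<in> PP" for p
    proof -
      have "v \<in> set p \<inter> range r" using hd[OF that] \<open>v \<in> range r\<close> by blast
      then have "last p = v" "is_path G p" "hd p = v" using path[OF that] by simp_all
      then show ?thesis by (cases p) (auto simp: is_path_def split: if_splits)
    qed
    then have "PP \<subseteq> {[v]}" by blast
    with PP show False by (meson finite.simps finite_subset)
  qed
  have "finite {p \<in> PP. x \<in> set p}" if "x \<in> X" for x
  proof (cases "\<exists>q. q \<in> PP \<and> x \<in> set q")
    case True
    then obtain q where q: "q \<in> PP" "x \<in> set q" by blast
    have "x \<noteq> v" using that X by blast
    then have "{p \<in> PP. x \<in> set p} \<subseteq> {q}" using disj[OF _ q(1)] q(2) by blast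
    then show ?thesis by (rule finite_subset) simp
  next
    case False
    then have "{p \<in> PP. x \<in> set p} = {}" by blast
    then show ?thesis by (metis finite.emptyI)
  qed
  then have "finite (\<Union>x\<in>X. {p \<in> PP. x \<in> set p})" using X by blast
  then have inf: "infinite (PP - (\<Union>x\<in>X. {p \<in> PP. x \<in> set p}))" (is "infinite ?Q")
    using PP by (rule Diff_infinite_finite)
  have "inj_on last ?Q"
  proof (rule inj_onI, rule ccontr)
    fix p q assume pq: "p \<in> ?Q" "q \<in> ?Q" "last p = last q" "p \<noteq> q"
    then have "last p \<in> set p \<inter> set q"
      using path[of p] path[of q] by auto
    then have "last p = v" using disj[of p q] pq by blast
    then show False using path[of p] pq vr by auto
  qed
  then have infl: "infinite (last ` ?Q)" using inf by (simp add: finite_image_iff)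
  obtain n where n: "\<forall>i\<ge>n. r i \<in> live G X r" using live_tail[OF r X(1)] by blast
  have "\<not> last ` ?Q \<subseteq> r ` {..<n}" using infl finite_subset by blast
  then obtain p where p: "p \<in> ?Q" "last p \<notin> r ` {..<n}" by blast
  then have pp: "is_path G p" "hd p = v" "last p \<in> range r" using path[of p] by auto
  then obtain i where i: "last p = r i" by blast
  then have "i \<ge> n" using p(2) by force
  have "set p \<subseteq> verts G - X" using p(1) pp(1) by (auto simp: is_path_def)
  then have "joined G (verts G - X) v (r i)"
    using joined_mono[OF joined_hd_last[OF pp(1)]] pp(2) i by metis
  then show ?thesis using n \<open>i \<ge> n\<close> live_memI[of G X v "r i" r] by simp
qed

lemma Dom_live:
  assumes G: "simple_graph G" "\<omega> \<in> ends G" and v: "v \<in> Dom G \<omega>" and r: "r \<in> \<omega>"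
    and X: "finite X" "v \<notin> X"
  shows "v \<in> live G X r"
proof -
  obtain s where s: "s \<in> \<omega>" "dominates_ray G v s" using v by (auto simp: Dom_def)
  then show ?thesis
    using dominator_live[OF end_ray[OF G s(1)] s(2) X] end_live[OF G r s(1) X(1)] by simp
qed

text \<open>Converse of \<open>Dom_live\<close>: the dominating vertices are exactly those that no
  finite set avoiding them separates from the end. The fan is built greedily, each new path avoiding
  all earlier ones except in \<open>v\<close>.\<close>

lemma live_Dom:
  assumes G: "simple_graph G" "\<omega> \<in> ends G" and r0: "r0 \<in> \<omega>" and v: "v \<in> verts G"
    and live0: "\<And>X. finite X \<Longrightarrow> v \<notin> X \<Longrightarrow> v \<in> live G X r0"
  shows "v \<in> Dom G \<omega>"
proof -
  \<comment> \<open>A vertex cannot dominate a ray through itself, so a tail beyond \<open>v\<close>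
    is used.\<close>
  obtain n where n: "\<forall>i\<ge>n. r0 i \<notin> {v}" using ray_avoids[OF end_ray[OF G r0], of "{v}"] by auto
  define r where "r = ray_tail n r0"
  have r: "r \<in> \<omega>" unfolding r_def by (rule end_ray_tail[OF G r0])
  have "r i \<noteq> v" for i using n[rule_format, of "n + i"] by (simp add: r_def ray_tail_def)
  then have vr: "v \<notin> range r" by blast
  have live: "v \<in> live G X r" if "finite X" "v \<notin> X" for X
    using live0[OF that] end_live[OF G r r0 that(1)] by simp
  define good where "good p \<longleftrightarrow> is_path G p \<and> hd p = v \<and> set p \<inter> range r = {last p}" for p
  have ex: "\<exists>p. good p \<and> set p \<inter> X = {}" if X: "finite X" "v \<notin> X" for X
  proof -
    obtain i where "joined G (verts G - X) v (r i)" using live[OF X] by (auto simp: live_def)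
    then obtain p where p: "is_path G p" "set p \<subseteq> verts G - X" "hd p = v" "last p = r i"
      using path_of_joined[of G "verts G - X"] by blast
    then have "last p \<in> set p" by (metis is_path_def last_in_set)
    then have "\<exists>x\<in>set p. x \<in> range r" using p(4) by auto
    then obtain ys x zs where sp: "p = ys @ x # zs" "x \<in> range r" "\<forall>y\<in>set ys. y \<notin> range r"
      using split_list_first_prop[of p "\<lambda>x. x \<in> range r"] by blast
    then have "is_path G ((ys @ [x]) @ zs)" using p by simp
    then have "is_path G (ys @ [x])" by (rule is_path_append1) simp
    moreover have "hd (ys @ [x]) = v" using p(3) sp(1) by (cases ys) auto
    moreover have "set (ys @ [x]) \<inter> X = {}" using p(2) sp(1) by auto
    ultimately show ?thesis using sp(2,3) unfolding good_def
      by (intro exI[of _ "ys @ [x]"]) auto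
  qed
  have "\<exists>f. \<forall>n::nat. good (f n) \<and> set (f n) \<inter> ((\<Union>i<n. set (f i)) - {v}) = {}"
  proof (rule dependent_wf_choice[of less_than "\<lambda>f n p. good p \<and> set p \<inter> ((\<Union>i<n. set (f i)) - {v}) = {}"])
    show "\<exists>p. good p \<and> set p \<inter> ((\<Union>i<n. set (f i)) - {v}) = {}" for f and n :: nat
      by (rule ex) auto
  qed auto
  then obtain f where f': "\<forall>n::nat. good (f n) \<and> set (f n) \<inter> ((\<Union>i<n. set (f i)) - {v}) = {}"
    by (elim exE)
  have f: "good (f n)" "set (f n) \<inter> ((\<Union>i<n. set (f i)) - {v}) = {}" for n using f' by simp_all
  have hd: "v \<in> set (f i)" for i using f(1)[of i] unfolding good_def is_path_def by (metis hd_in_set)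
  have d: "set (f i) \<inter> set (f j) = {v}" if "i \<noteq> j" for i j
  proof -
    have "set (f j) \<inter> set (f i) = {v}" if "i < j" for i j
      using f(2)[of j] that hd by blast
    from this[of i j] this[of j i] that show ?thesis by (cases "i < j") auto
  qed
  have "inj f"
  proof (rule injI, rule ccontr)
    fix i j assume ij: "f i = f j" "i \<noteq> j"
    then have "set (f i) = {v}" using d[of i j] by simp
    then show False using f(1)[of i] vr unfolding good_def by auto
  qed
  then have "infinite (range f)" by (simp add: finite_image_iff)
  moreover have "\<forall>p\<in>range f. \<forall>q\<in>range f. p \<noteq> q \<longrightarrow> set p \<inter> set q = {v}"
  proof (intro ballI impI)
    fix p q assume "p \<in> range f" "q \<in> range f" "p \<noteq> q"
    then obtain i j where "p = f i" "q = f j" "i \<noteq> j" by auto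
    then show "set p \<inter> set q = {v}" using d[of i j] by simp
  qed
  moreover have "\<forall>p\<in>range f. is_path G p \<and> hd p = v \<and> set p \<inter> range r = {last p}"
    using f(1) by (simp add: good_def)
  ultimately have "dominates_ray G v r"
    unfolding dominates_ray_def by (intro exI[of _ "range f"] conjI)
  then show ?thesis using r v by (auto simp: Dom_def)
qed

lemma Dom_joined:
  assumes "simple_graph G" "\<omega> \<in> ends G" "u \<in> Dom G \<omega>" "v \<in> Dom G \<omega>" "finite X" "u \<notin> X" "v \<notin> X"
  shows "joined G (verts G - X) u v"
proof -
  obtain r where "r \<in> \<omega>" using end_nonempty assms by blast
  then have "u \<in> live G X r" "v \<in> live G X r" using Dom_live[OF assms(1,2)] assms by simp_all
  then show ?thesis by (rule live_joined)
qed

subsection \<open>Topological minors\<close>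

lemma path_edges_sub: "is_path G p \<Longrightarrow> path_edges p \<subseteq> edges G"
  by (auto simp: is_path_def path_edges_def successively_conv_nth)

lemma path_edges_verts: "e \<in> path_edges p \<Longrightarrow> e \<subseteq> set p"
  by (auto simp: path_edges_def)

lemma is_path_in_path_edges:
  assumes "is_path G p" "set p \<subseteq> verts X" "path_edges p \<subseteq> edges X"
  shows "is_path X p"
proof -
  have "{p ! i, p ! Suc i} \<in> edges X" if "Suc i < length p" for i
    using assms(3) that unfolding path_edges_def by blast
  then show ?thesis using assms(1,2) unfolding is_path_def by (auto simp: successively_conv_nth)
qed

lemma simple_complete_graph: "simple_graph (complete_graph k)"
  unfolding simple_graph_def complete_graph_def by auto

lemma finite_edges: "simple_graph G \<Longrightarrow> finite (verts G) \<Longrightarrow> finite (edges G)"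
  by (rule finite_subset[of _ "Pow (verts G)"]) (auto simp: simple_graph_def)

text \<open>The subdivided edges are routed one at a time around the finitely many vertices used before.\<close>

lemma top_minor_of_linked:
  assumes G: "simple_graph G" and H: "simple_graph H" "finite (verts H)"
    and f: "inj_on f (verts H)" "f ` verts H \<subseteq> verts G"
    and link: "\<And>u v X. u \<in> f ` verts H \<Longrightarrow> v \<in> f ` verts H \<Longrightarrow> finite X \<Longrightarrow> u \<notin> X \<Longrightarrow> v \<notin> X
      \<Longrightarrow> joined G (verts G - X) u v"
  shows "\<exists>X. subgraph X G \<and> finite (verts X) \<and> is_subdivision X H"
proof -
  let ?D = "f ` verts H"
  define ok where "ok p e \<longleftrightarrow> is_path G p \<and> {hd p, last p} = f ` e \<and> inner_verts p \<inter> ?D = {}" for p e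
  have "\<exists>P. (\<forall>e\<in>\<E>. ok (P e) e) \<and>
      (\<forall>e\<in>\<E>. \<forall>e'\<in>\<E>. e \<noteq> e' \<longrightarrow> inner_verts (P e) \<inter> inner_verts (P e') = {})"
    if "finite \<E>" "\<E> \<subseteq> edges H" for \<E>
    using that
  proof (induction \<E> rule: finite_induct)
    case empty then show ?case by simp
  next
    case (insert e \<E>)
    then obtain P where P: "\<forall>e\<in>\<E>. ok (P e) e"
      "\<forall>e\<in>\<E>. \<forall>e'\<in>\<E>. e \<noteq> e' \<longrightarrow> inner_verts (P e) \<inter> inner_verts (P e') = {}" by auto
    obtain u v where uv: "u \<in> verts H" "v \<in> verts H" "u \<noteq> v" "e = {u, v}"
      using simple_graph_edge_cases[OF H(1), of e] insert.prems by auto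
    \<comment> \<open>Blocking the other branch vertices along with the old paths keeps the interior
      of the new path off every branch vertex.\<close>
    define X where "X = (?D \<union> (\<Union>e\<in>\<E>. set (P e))) - {f u, f v}"
    have "finite X" using insert.hyps H by (auto simp: X_def)
    then have "joined G (verts G - X) (f u) (f v)" using link uv by (auto simp: X_def)
    then obtain p where p: "is_path G p" "set p \<subseteq> verts G - X" "hd p = f u" "last p = f v"
      using path_of_joined[of G "verts G - X"] by blast
    have inn: "inner_verts p \<inter> ?D = {}" "\<And>e. e \<in> \<E> \<Longrightarrow> inner_verts p \<inter> set (P e) = {}"
      using p by (auto simp: inner_verts_def X_def)
    then have "ok p e" using p uv by (auto simp: ok_def)
    moreover have "inner_verts p \<inter> inner_verts (P e') = {}" if "e' \<in> \<E>" for e'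
      using inn(2)[OF that] by (auto simp: inner_verts_def)
    ultimately show ?case using P insert.hyps(2)
      by (intro exI[of _ "P(e := p)"]) (auto simp: Int_commute)
  qed
  from this[OF finite_edges[OF H] order_refl] obtain P where P': "\<forall>e\<in>edges H. ok (P e) e"
    and P2: "\<forall>e\<in>edges H. \<forall>e'\<in>edges H. e \<noteq> e' \<longrightarrow> inner_verts (P e) \<inter> inner_verts (P e') = {}" by blast
  have P: "ok (P e) e" if "e \<in> edges H" for e using P' that by simp
  have pG: "is_path G (P e)" if "e \<in> edges H" for e using P[OF that] by (simp add: ok_def)
  define X where "X = Graph (?D \<union> (\<Union>e\<in>edges H. set (P e))) (\<Union>e\<in>edges H. path_edges (P e))"
  have sub: "verts X \<subseteq> verts G" "edges X \<subseteq> edges G"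
    using f(2) pG path_edges_sub[OF pG] by (fastforce simp: X_def is_path_def)+
  have "simple_graph X" unfolding simple_graph_def
  proof
    fix e assume e: "e \<in> edges X"
    then obtain u v where uv: "u \<noteq> v" "e = {u, v}"
      using sub(2) simple_graph_edge_cases[OF G] by blast
    moreover have "e \<subseteq> verts X" using e path_edges_verts by (fastforce simp: X_def)
    ultimately show "\<exists>u v. u \<in> verts X \<and> v \<in> verts X \<and> u \<noteq> v \<and> e = {u, v}" by auto
  qed
  then have "subgraph X G" using sub by (simp add: subgraph_def)
  moreover have "finite (verts X)" using H finite_edges[OF H] by (simp add: X_def)
  moreover have "is_path X (P e)" if "e \<in> edges H" for e
    using that by (intro is_path_in_path_edges[OF pG]) (auto simp: X_def)
  then have "is_subdivision X H"
    unfolding is_subdivision_def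
    using f(1) P P2 unfolding ok_def by (intro exI[of _ f] exI[of _ P]) (simp add: X_def)
  ultimately show ?thesis by blast
qed

section \<open>From subdivisions of complete graphs to minors\<close>

lemma is_path_rev: "is_path G p \<Longrightarrow> is_path G (rev p)"
  by (auto simp: is_path_def insert_commute)

lemma is_path_butlast: "is_path G p \<Longrightarrow> butlast p \<noteq> [] \<Longrightarrow> is_path G (butlast p)"
  by (metis append_butlast_last_id butlast.simps(1) is_path_append1)

lemma is_path_last_edge:
  assumes "is_path G p" "butlast p \<noteq> []" shows "{last (butlast p), last p} \<in> edges G"
proof -
  have "p = butlast p @ [last p]" using assms by (metis append_butlast_last_id butlast.simps(1))
  then show ?thesis using assms unfolding is_path_def by (metis last_ConsL list.sel(1) not_Cons_self2 successively_append_iff)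
qed

text \<open>The interior of each subdivided edge is contracted onto its smaller end. Every interior
  then belongs to one branch set only, and the last edge of the path becomes the edge between the
  two branch sets.\<close>

lemma top_minor_imp_minor_complete:
  assumes "is_top_minor (complete_graph k) F"
  shows "is_minor (complete_graph k) F"
proof -
  obtain X where X: "subgraph X F" "is_subdivision X (complete_graph k)"
    using assms by (auto simp: is_top_minor_def)
  let ?K = "complete_graph k"
  obtain f P where f: "inj_on f (verts ?K)"
    and P': "\<forall>e\<in>edges ?K. is_path X (P e) \<and> {hd (P e), last (P e)} = f ` e
          \<and> inner_verts (P e) \<inter> f ` verts ?K = {}"
    and disj': "\<forall>e\<in>edges ?K. \<forall>e'\<in>edges ?K. e \<noteq> e' \<longrightarrow> inner_verts (P e) \<inter> inner_verts (P e') = {}"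
    and vX: "verts X = f ` verts ?K \<union> (\<Union>e\<in>edges ?K. set (P e))"
    using X(2) unfolding is_subdivision_def by (elim exE conjE)
  have P: "is_path X (P e) \<and> {hd (P e), last (P e)} = f ` e \<and> inner_verts (P e) \<inter> f ` verts ?K = {}"
    if "e \<in> edges ?K" for e using P' that by (rule bspec)
  have disj: "inner_verts (P e) \<inter> inner_verts (P e') = {}"
    if "e \<in> edges ?K" "e' \<in> edges ?K" "e \<noteq> e'" for e e' using disj' that by simp
  have vK: "verts ?K = {..<k}" by (simp add: complete_graph_def)
  have eK: "{x, y} \<in> edges ?K \<longleftrightarrow> x < k \<and> y < k \<and> x \<noteq> y" for x y
    by (auto simp: complete_graph_def doubleton_eq_iff)
  have XF: "verts X \<subseteq> verts F" "edges X \<subseteq> edges F" using X(1) by (auto simp: subgraph_def)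
  define B where "B x = insert (f x) (\<Union>y\<in>{x<..<k}. inner_verts (P {x, y}))" for x
  \<comment> \<open>A subdivided edge is indexed by an unordered pair, so its path may run in either
    direction and is reversed when needed.\<close>
  have path: "\<exists>q. is_path F q \<and> hd q = f x \<and> last q = f y \<and> inner_verts q = inner_verts (P {x, y})"
    if "x < y" "y < k" for x y
  proof -
    have xy: "{x, y} \<in> edges ?K" using that by (simp add: eK)
    have p: "is_path F (P {x, y})" "{hd (P {x, y}), last (P {x, y})} = {f x, f y}"
      using P[OF xy] XF by (auto intro: is_path_mono)
    have ne: "P {x, y} \<noteq> []" using p by (auto simp: is_path_def)
    show ?thesis
    proof (cases "hd (P {x, y}) = f x")
      case True
      with p show ?thesis by (intro exI[of _ "P {x, y}"]) (auto simp: doubleton_eq_iff)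
    next
      case False
      with p ne show ?thesis by (intro exI[of _ "rev (P {x, y})"])
        (auto simp: doubleton_eq_iff is_path_rev hd_rev last_rev inner_verts_def)
    qed
  qed
  have inn: "inner_verts (P {x, y}) \<subseteq> verts F" if "x < y" "y < k" for x y
  proof -
    have xy: "{x, y} \<in> edges ?K" using that by (simp add: eK)
    then show ?thesis using P[OF xy] XF by (auto simp: is_path_def inner_verts_def)
  qed
  have Bsub: "B x \<subseteq> verts F" if "x < k" for x
  proof -
    have "f x \<in> verts F" using that vX vK XF by auto
    moreover have "(\<Union>y\<in>{x<..<k}. inner_verts (P {x, y})) \<subseteq> verts F" using inn by (intro UN_least) simp
    ultimately show ?thesis by (simp add: B_def)
  qed
  have to_root: "joined F (B x) (f x) w" if xk: "x < k" and w: "w \<in> B x" for x w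
  proof (cases "w = f x")
    case True then show ?thesis by (auto intro!: joined_refl simp: B_def)
  next
    case False
    then obtain y where y: "x < y" "y < k" "w \<in> inner_verts (P {x, y})"
      using w by (auto simp: B_def)
    obtain q where q: "is_path F q" "hd q = f x" "last q = f y" "inner_verts q = inner_verts (P {x, y})"
      using path[OF y(1,2)] by blast
    have wq: "w \<in> set q" "w \<noteq> last q" using y(3) q(4) by (auto simp: inner_verts_def)
    have qe: "q = butlast q @ [last q]" using q(1) by (simp add: is_path_def)
    then have wb: "w \<in> set (butlast q)" using wq by (metis Un_iff empty_iff empty_set set_ConsD set_append)
    then have bp: "is_path F (butlast q)" using q(1) by (intro is_path_butlast) auto
    have hb: "hd (butlast q) = f x" using wb q(2) qe by (metis hd_append2 list.set(1) empty_iff)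
    have "distinct (butlast q @ [last q])" using qe q(1) by (simp add: is_path_def)
    then have "last q \<notin> set (butlast q)" by simp
    \<comment> \<open>Only the last vertex \<open>f y\<close> lies in the other branch set; without
      it the path stays in \<open>B x\<close>.\<close>
    then have "set (butlast q) \<subseteq> insert (f x) (inner_verts q)"
      using q(2) by (auto simp: inner_verts_def dest: in_set_butlastD)
    also have "\<dots> \<subseteq> B x" using y q(4) by (auto simp: B_def)
    finally show ?thesis using joined_mono[OF joined_hd_path[OF bp wb]] hb by simp
  qed
  have conn: "connected_graph (induced F (B x))" if "x < k" for x
    unfolding connected_induced_iff[OF Bsub[OF that]]
    using to_root[OF that] by (auto simp: B_def intro: joined_trans joined_sym)
  have edge: "\<exists>u\<in>B x. \<exists>v\<in>B y. {u, v} \<in> edges F" if xy: "x < y" "y < k" for x y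
  proof -
    obtain q where q: "is_path F q" "hd q = f x" "last q = f y" "inner_verts q = inner_verts (P {x, y})"
      using path[OF xy] by blast
    have fxy: "f x \<noteq> f y" using f xy by (auto simp: vK inj_on_def)
    have qe: "q = butlast q @ [last q]" using q(1) by (simp add: is_path_def)
    have nb: "butlast q \<noteq> []" using qe fxy q(2,3) by (metis append_Nil list.sel(1))
    have "last (butlast q) \<in> set (butlast q)" using nb by simp
    moreover have "distinct (butlast q @ [last q])" using qe q(1) by (simp add: is_path_def)
    ultimately have "last (butlast q) \<in> set q" "last (butlast q) \<noteq> last q"
      by (auto dest: in_set_butlastD)
    then have "last (butlast q) \<in> insert (f x) (inner_verts q)" using q(2) by (auto simp: inner_verts_def)
    then have "last (butlast q) \<in> B x" using q(4) xy by (auto simp: B_def)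
    moreover have "{last (butlast q), f y} \<in> edges F" using is_path_last_edge[OF q(1) nb] q(3) by simp
    ultimately show ?thesis by (auto simp: B_def)
  qed
  have dB: "B x \<inter> B y = {}" if xy: "x < k" "y < k" "x \<noteq> y" for x y
  proof (rule ccontr)
    assume "B x \<inter> B y \<noteq> {}"
    then obtain w where w: "w \<in> B x" "w \<in> B y" by blast
    have wx: "w = f x \<or> (\<exists>a. x < a \<and> a < k \<and> w \<in> inner_verts (P {x, a}))"
      and wy: "w = f y \<or> (\<exists>a. y < a \<and> a < k \<and> w \<in> inner_verts (P {y, a}))"
      using w by (auto simp: B_def)
    have fxy: "f x \<noteq> f y" using f xy by (auto simp: vK inj_on_def)
    have fin: "f z \<notin> inner_verts (P {a, b})" if "a < b" "b < k" "z < k" for z a b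
    proof -
      have ab: "{a, b} \<in> edges ?K" using that by (simp add: eK)
      have "f z \<in> f ` verts ?K" using that by (simp add: vK)
      then show ?thesis using P[OF ab] by blast
    qed
    have ii: "inner_verts (P {x, a}) \<inter> inner_verts (P {y, b}) = {}"
      if "x < a" "a < k" "y < b" "b < k" for a b
    proof (rule disj)
      show "{x, a} \<noteq> {y, b}" using that xy by (auto simp: doubleton_eq_iff)
    qed (use that xy in \<open>auto simp: eK\<close>)
    from wx show False
    proof
      assume "w = f x"
      with wy fxy obtain a where "y < a" "a < k" "f x \<in> inner_verts (P {y, a})" by auto
      then show False using fin xy by simp
    next
      assume "\<exists>a. x < a \<and> a < k \<and> w \<in> inner_verts (P {x, a})"
      then obtain a where a: "x < a" "a < k" "w \<in> inner_verts (P {x, a})" by blast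
      from wy show False
      proof
        assume "w = f y"
        with a show False using fin xy by simp
      next
        assume "\<exists>b. y < b \<and> b < k \<and> w \<in> inner_verts (P {y, b})"
        then obtain b where "y < b" "b < k" "w \<in> inner_verts (P {y, b})" by blast
        with a show False using ii[of a b] by auto
      qed
    qed
  qed
  show ?thesis unfolding is_minor_def
  proof (intro exI[of _ B] conjI ballI allI impI)
    fix x y assume "{x, y} \<in> edges ?K"
    then have xy: "x < k" "y < k" "x \<noteq> y" by (auto simp: eK)
    show "\<exists>u\<in>B x. \<exists>v\<in>B y. {u, v} \<in> edges F"
    proof (cases "x < y")
      case True then show ?thesis using edge xy by blast
    next
      case False
      then have "\<exists>u\<in>B y. \<exists>v\<in>B x. {u, v} \<in> edges F" using edge xy by simp
      then show ?thesis by (metis insert_commute)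
    qed
  qed (use Bsub conn dB in \<open>auto simp: vK\<close>)
qed

text \<open>For every finite \<open>X\<close>, all dominating vertices outside \<open>X\<close> lie
  in the one component of \<open>G - X\<close> where the end lives. So any two of them are linked
  around \<open>X\<close>, and \<open>k\<close> of them serve as branch vertices.\<close>

lemma top_minor_of_Dom:
  assumes G: "simple_graph G" and \<omega>: "\<omega> \<in> ends G"
    and k: "infinite (Dom G \<omega>) \<or> k \<le> card (Dom G \<omega>)"
  shows "\<exists>F. subgraph F G \<and> finite (verts F) \<and> is_top_minor (complete_graph k) F"
proof -
  obtain D where D: "D \<subseteq> Dom G \<omega>" "card D = k" "finite D"
    using k infinite_arbitrarily_large[of "Dom G \<omega>" k] obtain_subset_with_card_n[of k "Dom G \<omega>"]
    by (metis)
  then obtain f where f: "bij_betw f {..<k} D"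
    using ex_bij_betw_nat_finite[of D] by (auto simp: atLeast0LessThan)
  have vK: "verts (complete_graph k) = {..<k}" by (simp add: complete_graph_def)
  have "\<exists>X. subgraph X G \<and> finite (verts X) \<and> is_subdivision X (complete_graph k)"
  proof (rule top_minor_of_linked[OF G simple_complete_graph, of k f])
    show "f ` verts (complete_graph k) \<subseteq> verts G"
      using f D(1) by (auto simp: vK bij_betw_def Dom_def)
    fix u v X assume "u \<in> f ` verts (complete_graph k)" "v \<in> f ` verts (complete_graph k)"
      "finite X" "u \<notin> X" "v \<notin> X"
    then show "joined G (verts G - X) u v"
      using f D(1) by (intro Dom_joined[OF G \<omega>]) (auto simp: vK bij_betw_def)
  qed (use f in \<open>auto simp: vK bij_betw_def\<close>)
  then obtain X where X: "subgraph X G" "finite (verts X)" "is_subdivision X (complete_graph k)" by blast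
  then have "subgraph X X" by (simp add: subgraph_def)
  with X show ?thesis unfolding is_top_minor_def by blast
qed

subsection \<open>Regions of undominated ends\<close>

definition avoiding :: "'a graph \<Rightarrow> (nat \<Rightarrow> 'a) \<Rightarrow> 'a set \<Rightarrow> 'a set \<Rightarrow> bool" where
  "avoiding G r Y S \<longleftrightarrow> finite S \<and> S \<subseteq> verts G \<and> S \<inter> Y = {} \<and> live G S r \<inter> Y = {}"

lemma live_whole:
  assumes "is_ray G r" shows "r i \<in> live G {} r"
proof -
  have "live G {} r = {u. joined G (verts G) (r i) u}" using live_eq_class[OF assms, of 0 "{}" i] by simp
  then show ?thesis using assms by (auto simp: is_ray_def intro!: joined_refl)
qed

text \<open>Taking the neighbourhood of the component behind a separator that contains \<open>Y\<close> keeps the new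
  separator disjoint from \<open>Y\<close>, because every vertex of \<open>Y\<close> is itself separated from the end.\<close>

lemma avoiding_exists:
  assumes r: "is_ray G r" and Y: "finite Y"
    and sep: "\<And>y. y \<in> Y \<Longrightarrow> \<exists>X. finite X \<and> y \<notin> X \<and> y \<notin> live G X r"
  shows "\<exists>S. avoiding G r Y S"
proof -
  have "\<forall>y\<in>Y. \<exists>X. finite X \<and> y \<notin> X \<and> y \<notin> live G X r" using sep by (intro ballI)
  then obtain X where X: "\<forall>y\<in>Y. finite (X y) \<and> y \<notin> X y \<and> y \<notin> live G (X y) r"
    by (elim bchoice[THEN exE])
  define S0 where "S0 = (\<Union>y\<in>Y. X y) \<union> Y"
  have S0: "finite S0" using X Y by (simp add: S0_def)
  define C where "C = live G S0 r"
  define S where "S = {s \<in> verts G - C. \<exists>c\<in>C. {c, s} \<in> edges G}"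
  have "S \<subseteq> S0"
  proof
    fix s assume s: "s \<in> S"
    then obtain c where c: "c \<in> C" "{c, s} \<in> edges G" by (auto simp: S_def)
    show "s \<in> S0"
    proof (rule ccontr)
      assume "s \<notin> S0"
      then have "s \<in> C" using live_step[of c G S0 r s] c s by (simp add: C_def S_def)
      then show False using s by (simp add: S_def)
    qed
  qed
  have Cdisj: "C \<inter> Y = {}" using live_sub[of G S0 r] by (auto simp: C_def S0_def)
  have "live G S r \<subseteq> C"
  proof (rule live_closed[OF r])
    show "finite S" using \<open>S \<subseteq> S0\<close> S0 by (rule finite_subset)
    obtain n where "\<forall>i\<ge>n. r i \<in> C" using live_tail[OF r S0] by (auto simp: C_def)
    then have "r (max n m) \<in> C" for m by simp
    then show "\<exists>i\<ge>m. r i \<in> C" for m using max.cobounded2 by blast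
    show "y \<in> C" if "x \<in> C" "y \<in> verts G - S" "{x, y} \<in> edges G" for x y
      using that by (auto simp: S_def)
  qed
  moreover have "s \<notin> Y" if "s \<in> S" for s
  proof
    assume sY: "s \<in> Y"
    obtain c where c: "c \<in> C" "{c, s} \<in> edges G" using \<open>s \<in> S\<close> by (auto simp: S_def)
    \<comment> \<open>Deleting only \<open>X s\<close> leaves \<open>C\<close> on the side of the
      end. A neighbour \<open>s\<close> of \<open>C\<close> outside \<open>X s\<close> would then be
      on that side as well.\<close>
    have "X s \<subseteq> S0" using sY by (auto simp: S0_def)
    then have "c \<in> live G (X s) r" using live_mono[of "X s" S0 G r] c(1) by (auto simp: C_def)
    then have "s \<in> live G (X s) r" using live_step[of c G "X s" r s] c(2) X sY \<open>s \<in> S\<close> by (simp add: S_def)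
    then show False using X sY by simp
  qed
  ultimately have "avoiding G r Y S"
    unfolding avoiding_def using \<open>S \<subseteq> S0\<close> S0 Cdisj finite_subset[of S S0] by (auto simp: S_def)
  then show ?thesis by blast
qed

text \<open>Minimality is by inclusion and asks only that the end can again reach \<open>Y\<close>,
  to match \<open>minimal_separator\<close>.\<close>

definition min_avoiding :: "'a graph \<Rightarrow> (nat \<Rightarrow> 'a) \<Rightarrow> 'a set \<Rightarrow> 'a set \<Rightarrow> bool" where
  "min_avoiding G r Y S \<longleftrightarrow> avoiding G r Y S \<and> (\<forall>T. T \<subset> S \<longrightarrow> live G T r \<inter> Y \<noteq> {})"

lemma min_avoiding_exists:
  assumes "avoiding G r Y S0" shows "\<exists>S. min_avoiding G r Y S"
proof -
  obtain S where S: "avoiding G r Y S" "\<forall>T. avoiding G r Y T \<longrightarrow> card S \<le> card T"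
    using ex_has_least_nat[of "avoiding G r Y" S0 card] assms by blast
  have "live G T r \<inter> Y \<noteq> {}" if "T \<subset> S" for T
  proof
    assume "live G T r \<inter> Y = {}"
    then have "avoiding G r Y T" using S(1) that by (auto simp: avoiding_def intro: finite_subset)
    moreover have "card T < card S" using S(1) that by (intro psubset_card_mono) (auto simp: avoiding_def)
    ultimately show False using S(2) by (simp add: leD)
  qed
  then show ?thesis using S(1) by (auto simp: min_avoiding_def)
qed

text \<open>If \<open>s\<close> lacked neighbours on one side, putting it back would not connect the
  end to \<open>Y\<close>. A neighbour on the side of the end makes the component together with
  \<open>S\<close> connected; one on the far side makes \<open>s\<close> a boundary vertex.\<close>

lemma min_avoiding_nbrs:
  assumes r: "is_ray G r" and S: "min_avoiding G r Y S" and s: "s \<in> S"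
  shows "\<exists>c\<in>live G S r. {c, s} \<in> edges G"
    and "\<exists>w\<in>verts G - (live G S r \<union> S). {s, w} \<in> edges G"
proof -
  let ?C = "live G S r" and ?T = "S - {s}"
  have fin: "finite S" "S \<subseteq> verts G" "S \<inter> Y = {}" "?C \<inter> Y = {}"
    using S by (auto simp: min_avoiding_def avoiding_def)
  obtain n where n: "\<forall>i\<ge>n. r i \<in> ?C" using live_tail[OF r fin(1)] by blast
  have frq: "\<exists>i\<ge>m. r i \<in> ?C" for m using n by (intro exI[of _ "max n m"]) simp
  have T: "live G ?T r \<inter> Y \<noteq> {}" using S s by (auto simp: min_avoiding_def)
  show "\<exists>c\<in>?C. {c, s} \<in> edges G"
  proof (rule ccontr)
    assume no: "\<not> (\<exists>c\<in>?C. {c, s} \<in> edges G)"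
    have "live G ?T r \<subseteq> ?C"
    proof (rule live_closed[OF r _ frq])
      show "y \<in> ?C" if "x \<in> ?C" "y \<in> verts G - ?T" "{x, y} \<in> edges G" for x y
        using that no by (intro live_step[OF that(1,3)]) auto
    qed (use fin in simp)
    then show False using T fin(4) by blast
  qed
  show "\<exists>w\<in>verts G - (?C \<union> S). {s, w} \<in> edges G"
  proof (rule ccontr)
    assume no: "\<not> (\<exists>w\<in>verts G - (?C \<union> S). {s, w} \<in> edges G)"
    have "live G ?T r \<subseteq> insert s ?C"
    proof (rule live_closed[OF r])
      show "\<exists>i\<ge>m. r i \<in> insert s ?C" for m using frq[of m] by auto
      fix x y assume xy: "x \<in> insert s ?C" "y \<in> verts G - ?T" "{x, y} \<in> edges G"
      show "y \<in> insert s ?C"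
      proof (cases "x = s")
        case True then show ?thesis using no xy by blast
      next
        case False
        then show ?thesis using xy live_step[of x G S r y] by auto
      qed
    qed (use fin in simp)
    then show False using T fin(3,4) s by blast
  qed
qed

text \<open>The separator is included in the region, so that it becomes exactly the vertex
  boundary.\<close>

lemma min_avoiding_region:
  assumes G: "simple_graph G" "\<omega> \<in> ends G" and r: "r \<in> \<omega>" and S: "min_avoiding G r Y S"
  defines "H \<equiv> induced G (live G S r \<union> S)"
  shows "verts H = live G S r \<union> S" "vert_boundary G H = S" "is_region G \<omega> H"
proof -
  let ?C = "live G S r"
  have ray: "is_ray G r" using end_ray[OF G r] .
  have fin: "finite S" "S \<subseteq> verts G" using S by (auto simp: min_avoiding_def avoiding_def)
  show vH: "verts H = ?C \<union> S" using fin live_sub[of G S r] by (auto simp: H_def)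
  have "u \<in> S" if "u \<in> ?C \<union> S" "v \<in> verts G - (?C \<union> S)" "{u, v} \<in> edges G" for u v
    using live_step[of u G S r v] that by auto
  moreover have "\<exists>v\<in>verts G - (?C \<union> S). {s, v} \<in> edges G" if "s \<in> S" for s
    using min_avoiding_nbrs(2)[OF ray S that] .
  ultimately show vb: "vert_boundary G H = S" unfolding vert_boundary_def vH by auto
  obtain n where n: "\<forall>i\<ge>n. r i \<in> ?C" using live_tail[OF ray fin(1)] by blast
  have conn: "connected_graph H"
  proof -
    have "joined G (?C \<union> S) (r n) u" if "u \<in> ?C \<union> S" for u
    proof -
      have C: "joined G (?C \<union> S) (r n) u" if "u \<in> ?C" for u
        using joined_mono[OF live_joined_inside[OF ray fin(1)], of "r n" u "?C \<union> S"] n that by simp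
      show ?thesis
      proof (cases "u \<in> ?C")
        case False
        then have "u \<in> S" using that by simp
        then obtain c where "c \<in> ?C" "{c, u} \<in> edges G" using min_avoiding_nbrs(1)[OF ray S] by blast
        then show ?thesis using C[of c] \<open>u \<in> S\<close> joined_step[of G "?C \<union> S" "r n" c u] by simp
      qed (rule C)
    qed
    moreover have "?C \<union> S \<subseteq> verts G" using fin(2) live_sub[of G S r] by auto
    moreover have "r n \<in> ?C" using n by simp
    ultimately show ?thesis
      unfolding H_def by (subst connected_induced_iff) (blast intro: joined_trans joined_sym)+
  qed
  have "is_ray H (ray_tail n r)"
  proof -
    have "ray_tail n r i \<in> ?C" for i using n by (simp add: ray_tail_def)
    then show ?thesis using is_ray_tail[OF ray, of n] vH by (auto simp: is_ray_def H_def)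
  qed
  then have "contains_ray_of H \<omega>" using end_ray_tail[OF G r] by (auto simp: contains_ray_of_def)
  then show "is_region G \<omega> H" using conn vb fin G(1) vH subgraph_induced[OF G(1)]
    by (simp add: is_region_def H_def)
qed

lemma is_ray_induced: "is_ray (induced G A) r \<longleftrightarrow> is_ray G r \<and> range r \<subseteq> A"
  by (auto simp: is_ray_def)

text \<open>Outside the finite set \<open>S\<close> the region is the component where \<omega>
  lives, so every end with a ray in the region lives there too, away from \<open>Y\<close>. For a
  smaller set, \<omega> itself shows the failure to separate.\<close>

lemma min_avoiding_minimal_separator:
  assumes G: "simple_graph G" "\<omega> \<in> ends G" and r: "r \<in> \<omega>" and S: "min_avoiding G r Y S" and Y: "Y \<noteq> {}"
  shows "minimal_separator G Y (ends_in G (induced G (live G S r \<union> S))) S"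
proof -
  let ?C = "live G S r" and ?H = "induced G (live G S r \<union> S)"
  have ray: "is_ray G r" using end_ray[OF G r] .
  have fin: "finite S" "S \<subseteq> verts G" "S \<inter> Y = {}" "?C \<inter> Y = {}"
    using S by (auto simp: min_avoiding_def avoiding_def)
  have "\<not> (verts K \<inter> Y \<noteq> {} \<and> (\<exists>\<omega>2\<in>ends_in G ?H. contains_ray_of K \<omega>2))"
    if K: "is_component K (del_verts G S)" for K
  proof
    assume A: "verts K \<inter> Y \<noteq> {} \<and> (\<exists>\<omega>2\<in>ends_in G ?H. contains_ray_of K \<omega>2)"
    then obtain \<omega>2 r2 r3 where o: "\<omega>2 \<in> ends G" "r2 \<in> \<omega>2" "is_ray ?H r2" "r3 \<in> \<omega>2" "is_ray K r3"
      by (auto simp: ends_in_def contains_ray_of_def)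
    have r23: "is_ray G r2" "is_ray G r3" using end_ray[OF G(1) o(1)] o(2,4) by auto
    obtain n where n: "\<forall>i\<ge>n. r2 i \<in> live G S r2" using live_tail[OF r23(1) fin(1)] by blast
    have "r2 n \<in> ?C"
    proof -
      have "r2 n \<in> ?C \<union> S" using o(3) by (auto simp: is_ray_induced)
      moreover have "r2 n \<notin> S" using n live_sub[of G S r2] by auto
      ultimately show ?thesis by simp
    qed
    then have e2: "live G S r2 = ?C" using n live_eqI[of "r2 n" G S r2 r] by simp
    obtain l where l: "\<forall>i\<ge>l. r3 i \<in> live G S r3" using live_tail[OF r23(2) fin(1)] by blast
    have "r3 l \<in> ?C" using l e2 end_live[OF G(1) o(1,2,4) fin(1)] by simp
    moreover have "r3 l \<in> verts K" using o(5) by (auto simp: is_ray_def)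
    ultimately have "verts K = ?C" using component_eq_live(1)[OF G(1) K] by blast
    then show False using A fin(4) by simp
  qed
  then have "separator G Y (ends_in G ?H) S" unfolding separator_def using fin Y by auto
  moreover have "\<not> separator G Y (ends_in G ?H) T" if T: "T \<subset> S" for T
  proof
    assume sep: "separator G Y (ends_in G ?H) T"
    have finT: "finite T" using T fin(1) by (auto intro: finite_subset)
    have K: "is_component (induced G (live G T r)) (del_verts G T)" by (rule live_component[OF G(1) ray finT])
    have "live G T r \<inter> Y \<noteq> {}" using S T by (simp add: min_avoiding_def)
    then have "verts (induced G (live G T r)) \<inter> Y \<noteq> {}" using live_sub[of G T r] by auto
    moreover have "\<omega> \<in> ends_in G ?H"
      using min_avoiding_region(3)[OF G r S] G(2) unfolding ends_in_def is_region_def by blast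
    moreover have "contains_ray_of (induced G (live G T r)) \<omega>"
    proof -
      obtain n where n: "\<forall>i\<ge>n. r i \<in> live G T r" using live_tail[OF ray finT] by blast
      then have "is_ray (induced G (live G T r)) (ray_tail n r)"
        using is_ray_tail[OF ray] by (auto simp: is_ray_induced ray_tail_def)
      then show ?thesis using end_ray_tail[OF G r] by (auto simp: contains_ray_of_def)
    qed
    ultimately show False using sep K unfolding separator_def by blast
  qed
  ultimately show ?thesis by (simp add: minimal_separator_def)
qed

lemma min_avoiding_nonempty:
  assumes "min_avoiding G r Y S" "live G {} r \<inter> Y \<noteq> {}" shows "S \<noteq> {}"
  using assms by (auto simp: min_avoiding_def avoiding_def)

lemma undominated_min_avoiding:
  assumes G: "simple_graph G" "\<omega> \<in> ends G" and r: "r \<in> \<omega>" and D: "Dom G \<omega> = {}" and Y: "finite Y"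
  shows "\<exists>S. min_avoiding G r Y S"
proof -
  have "\<exists>X. finite X \<and> y \<notin> X \<and> y \<notin> live G X r" for y
  proof (cases "y \<in> verts G")
    case True
    then show ?thesis using live_Dom[OF G r, of y] D by auto
  next
    case False
    then show ?thesis using live_sub[of G "{}" r] by (intro exI[of _ "{}"]) auto
  qed
  then show ?thesis
    using avoiding_exists[OF end_ray[OF G r] Y] min_avoiding_exists by blast
qed

text \<open>The next region is cut off by a minimal set separating the end from the old boundary.
  Nonempty boundaries are carried along because \<open>separator\<close> cannot hold for an empty
  set to be separated.\<close>

lemma region_step:
  assumes G: "simple_graph G" "\<omega> \<in> ends G" and D: "Dom G \<omega> = {}"
    and H: "is_region G \<omega> H" "vert_boundary G H \<noteq> {}"
  shows "\<exists>H'. is_region G \<omega> H' \<and> vert_boundary G H' \<noteq> {}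
    \<and> subgraph H' (del_verts H (vert_boundary G H))
    \<and> minimal_separator G (vert_boundary G H) (ends_in G H') (vert_boundary G H')"
proof -
  let ?B = "vert_boundary G H"
  obtain r where r: "r \<in> \<omega>" "is_ray H r" using H(1) by (auto simp: is_region_def contains_ray_of_def)
  have ray: "is_ray G r" using end_ray[OF G r(1)] .
  have Hi: "H = induced G (verts H)" "connected_graph H" "finite ?B" "verts H \<subseteq> verts G"
    using H(1) by (auto simp: is_region_def subgraph_def)
  have BH: "?B \<subseteq> verts H" by (auto simp: vert_boundary_def)
  have jH: "joined G (verts H) u v" if "u \<in> verts H" "v \<in> verts H" for u v
    using connected_induced_iff[OF Hi(4)] Hi(1,2) that by simp
  obtain S where S: "min_avoiding G r ?B S"
    using undominated_min_avoiding[OF G r(1) D Hi(3)] by blast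
  have "live G {} r \<inter> ?B \<noteq> {}"
  proof -
    obtain b where b: "b \<in> ?B" using H(2) by blast
    have "joined G (verts H) b (r 0)" using b BH r(2) by (intro jH) (auto simp: is_ray_def)
    then have "joined G (verts G - {}) b (r 0)" using Hi(4) by (auto intro: joined_mono)
    then show ?thesis using live_memI[OF _ live_whole[OF ray]] b by blast
  qed
  then have Sne: "S \<noteq> {}" using min_avoiding_nonempty[OF S] by simp
  define H' where "H' = induced G (live G S r \<union> S)"
  note reg = min_avoiding_region[OF G r(1) S, folded H'_def]
  have disj: "verts H' \<inter> ?B = {}" using S unfolding reg(1) min_avoiding_def avoiding_def by auto
  have fin: "finite S" using S by (simp add: min_avoiding_def avoiding_def)
  obtain n where n: "\<forall>i\<ge>n. r i \<in> live G S r" using live_tail[OF ray fin] by blast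
  have HV': "verts H' \<subseteq> verts G" by (auto simp: H'_def)
  \<comment> \<open>The new region is connected and meets \<open>H\<close> in the ray; it could
    leave \<open>H\<close> only through the old boundary, which it avoids.\<close>
  have "u \<in> verts H" if "u \<in> verts H'" for u
  proof -
    have "connected_graph H'" using reg(3) by (simp add: is_region_def)
    moreover have "H' = induced G (verts H')" using reg(3) by (simp add: is_region_def)
    moreover have rn: "r n \<in> verts H'" using n reg(1) by simp
    ultimately have "joined G (verts H') (r n) u"
      using connected_induced_iff[OF HV'] that by metis
    then show ?thesis
    proof (rule joined_closed)
      show "r n \<in> verts H" using r(2) by (auto simp: is_ray_def)
      show "y \<in> verts H" if "x \<in> verts H" "x \<in> verts H'" "y \<in> verts H'" "{x, y} \<in> edges G" for x y
        using that disj HV' by (auto simp: vert_boundary_def)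
    qed
  qed
  then have sub: "verts H' \<subseteq> verts H - ?B" using disj by auto
  have "subgraph H' (del_verts H ?B)"
  proof -
    have "edges H = {e \<in> edges G. e \<subseteq> verts H}" using Hi(1) by (metis edges_induced)
    moreover have "edges H' = {e \<in> edges G. e \<subseteq> verts H'}" unfolding reg(1) by (simp add: H'_def)
    ultimately show ?thesis using sub simple_graph_induced[OF G(1)]
      by (auto simp: subgraph_def H'_def)
  qed
  moreover have "minimal_separator G ?B (ends_in G H') (vert_boundary G H')"
    unfolding reg(2) using min_avoiding_minimal_separator[OF G r(1) S H(2)] by (simp add: H'_def)
  ultimately show ?thesis using reg(2,3) Sne by blast
qed

lemma regions_to_exists:
  assumes G: "simple_graph G" "\<omega> \<in> ends G" and D: "Dom G \<omega> = {}" and Y: "finite Y"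
  shows "\<exists>H. regions_to G H \<omega> \<and> (\<forall>i. verts (H i) \<inter> Y = {} \<and> vert_boundary G (H i) \<noteq> {})"
proof -
  obtain r where r: "r \<in> \<omega>" using end_nonempty[OF G] by blast
  have ray: "is_ray G r" using end_ray[OF G r] .
  \<comment> \<open>Separating from \<open>r 0\<close> as well forces the initial boundary to be
    nonempty, even when \<open>Y\<close> misses the component of the ray.\<close>
  let ?Y = "insert (r 0) Y"
  obtain S where S: "min_avoiding G r ?Y S"
    using undominated_min_avoiding[OF G r D, of ?Y] Y by auto
  have Sne: "S \<noteq> {}" using min_avoiding_nonempty[OF S] live_whole[OF ray, of 0] by auto
  let ?P = "\<lambda>(_::nat) H. is_region G \<omega> H \<and> vert_boundary G H \<noteq> {} \<and> verts H \<inter> Y = {}"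
  let ?Q = "\<lambda>(_::nat) H H'. subgraph H' (del_verts H (vert_boundary G H))
    \<and> minimal_separator G (vert_boundary G H) (ends_in G H') (vert_boundary G H')"
  have "\<exists>H. ?P 0 H"
  proof (intro exI conjI)
    show "is_region G \<omega> (induced G (live G S r \<union> S))"
      "vert_boundary G (induced G (live G S r \<union> S)) \<noteq> {}"
      using min_avoiding_region(2,3)[OF G r S] Sne by auto
    show "verts (induced G (live G S r \<union> S)) \<inter> Y = {}"
      using S by (auto simp: min_avoiding_def avoiding_def)
  qed
  moreover have "\<exists>H'. ?P (Suc n) H' \<and> ?Q n H H'" if PH: "?P n H" for n :: nat and H
  proof -
    obtain H' where H': "is_region G \<omega> H'" "vert_boundary G H' \<noteq> {}"
      "subgraph H' (del_verts H (vert_boundary G H))"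
      "minimal_separator G (vert_boundary G H) (ends_in G H') (vert_boundary G H')"
      using region_step[OF G D, of H] PH by blast
    then have "verts H' \<subseteq> verts H" by (auto simp: subgraph_def)
    then have "verts H' \<inter> Y = {}" using PH by auto
    then show ?thesis using H' by blast
  qed
  ultimately obtain H where H: "\<forall>n. ?P n (H n) \<and> ?Q n (H n) (H (Suc n))"
    using dependent_nat_choice[of ?P ?Q] by auto
  have sub: "verts (H (Suc i)) \<subseteq> verts (H i) - vert_boundary G (H i)" for i
    using H by (auto simp: subgraph_def)
  have "verts (H j) \<subseteq> verts (H i) - vert_boundary G (H i)" if "i < j" for i j
    using that
  proof (induction rule: strict_inc_induct)
    case (base i) then show ?case by (metis sub)
  next
    case (step i) then show ?case using sub[of i] by auto
  qed
  moreover have "vert_boundary G (H i) \<noteq> {}" "vert_boundary G (H i) \<subseteq> verts (H i)" for i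
    using H by (auto simp: vert_boundary_def)
  ultimately have "H i \<noteq> H j" if "i < j" for i j using that by (metis Diff_disjoint disjoint_iff equals0I subsetD)
  then have "inj H" by (metis injI linorder_neqE_nat)
  then have "regions_to G H \<omega>" using H by (simp add: regions_to_def)
  then show ?thesis using H by (intro exI[of _ H]) simp
qed

subsection \<open>Relative degree\<close>

lemma is_ray_del_verts: "is_ray (del_verts G D) r \<longleftrightarrow> is_ray G r \<and> range r \<inter> D = {}"
proof -
  have "range r \<inter> D = {} \<longleftrightarrow> (\<forall>i. r i \<notin> D)" by auto
  then show ?thesis by (auto simp: is_ray_def)
qed

lemma joined_del_verts:
  assumes "A \<inter> D = {}" "A \<subseteq> verts G" shows "joined (del_verts G D) A u v \<longleftrightarrow> joined G A u v"
proof
  assume "joined (del_verts G D) A u v"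
  then show "joined G A u v" by (rule joined_mono_graph) auto
next
  assume "joined G A u v"
  then show "joined (del_verts G D) A u v" by (rule joined_mono_graph) (use assms in auto)
qed

lemma live_del_verts: "live (del_verts G D) X r = live G (X \<union> D) r"
proof -
  have "verts (del_verts G D) - X = verts G - (X \<union> D)" by auto
  then show ?thesis unfolding live_def by (simp add: joined_del_verts Int_Diff Diff_Int_distrib2)
qed

text \<open>For finite \<open>D\<close> this is the end of \<open>G - D\<close> induced by \<omega>,
  written with a hat in the definition of relative degree.\<close>

definition end_minus :: "'a graph \<Rightarrow> 'a set \<Rightarrow> (nat \<Rightarrow> 'a) set \<Rightarrow> (nat \<Rightarrow> 'a) set" where
  "end_minus G D \<omega> = {s \<in> \<omega>. range s \<inter> D = {}}"

context
  fixes G :: "'a graph" and \<omega> :: "(nat \<Rightarrow> 'a) set" and D :: "'a set"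
  assumes G: "simple_graph G" "\<omega> \<in> ends G" and D: "finite D"
begin

lemma ray_outside: "\<exists>r. r \<in> end_minus G D \<omega>"
proof -
  obtain r where r: "r \<in> \<omega>" using end_nonempty[OF G] by blast
  obtain n where n: "\<forall>i\<ge>n. r i \<notin> D" using ray_avoids[OF end_ray[OF G r] D] by blast
  then have "range (ray_tail n r) \<inter> D = {}" by (auto simp: ray_tail_def)
  then show ?thesis using end_ray_tail[OF G r] by (auto simp: end_minus_def)
qed

lemma end_minus_end: "end_minus G D \<omega> \<in> ends (del_verts G D)"
proof -
  obtain r where r: "r \<in> \<omega>" "range r \<inter> D = {}" using ray_outside by (auto simp: end_minus_def)
  have ray: "is_ray G r" using end_ray[OF G r(1)] .
  have "end_minus G D \<omega> = {s. is_ray (del_verts G D) s \<and>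
      (\<forall>X. finite X \<longrightarrow> live (del_verts G D) X s = live (del_verts G D) X r)}" (is "_ = ?R")
  proof (intro equalityI subsetI)
    fix s assume "s \<in> end_minus G D \<omega>"
    then have s: "s \<in> \<omega>" "range s \<inter> D = {}" by (auto simp: end_minus_def)
    then show "s \<in> ?R" using end_ray[OF G s(1)] end_live[OF G s(1) r(1)] D
      by (simp add: is_ray_del_verts live_del_verts)
  next
    fix s assume "s \<in> ?R"
    then have s: "is_ray G s" "range s \<inter> D = {}"
      and live: "\<And>X. finite X \<Longrightarrow> live G (X \<union> D) s = live G (X \<union> D) r"
      by (auto simp: is_ray_del_verts live_del_verts)
    \<comment> \<open>Equality of live components is known only for sets containing
      \<open>D\<close>. Since they grow when vertices are put back and coincide once they meet, a
      common vertex carries the equality over to \<open>X\<close>.\<close>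
    have "s \<in> \<omega>"
    proof (rule end_memI[OF G r(1) s(1)])
      fix X :: "'a set" assume X: "finite X"
      obtain n where "\<forall>i\<ge>n. s i \<in> live G (X \<union> D) s" using live_tail[OF s(1)] X D by blast
      then have "s n \<in> live G (X \<union> D) s" "s n \<in> live G (X \<union> D) r" using live[OF X] by auto
      then have "s n \<in> live G X s" "s n \<in> live G X r"
        using live_mono[of X "X \<union> D" G s] live_mono[of X "X \<union> D" G r] by auto
      then show "live G X s = live G X r" by (rule live_eqI)
    qed
    then show "s \<in> end_minus G D \<omega>" using s(2) by (simp add: end_minus_def)
  qed
  then show ?thesis
    unfolding ends_iff[OF simple_graph_del_verts[OF G(1)]]
    using ray r(2) by (intro exI[of _ r]) (simp add: is_ray_del_verts)
qed

text \<open>Evaluates the definite description in \<open>rel_degree\<close>.\<close>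

lemma end_minus_unique:
  "(THE \<omega>'. \<omega>' \<in> ends (del_verts G D) \<and> \<omega>' \<inter> \<omega> \<noteq> {}) = end_minus G D \<omega>"
proof (rule the_equality)
  show "end_minus G D \<omega> \<in> ends (del_verts G D) \<and> end_minus G D \<omega> \<inter> \<omega> \<noteq> {}"
    using end_minus_end ray_outside by (auto simp: end_minus_def)
  fix \<omega>' assume "\<omega>' \<in> ends (del_verts G D) \<and> \<omega>' \<inter> \<omega> \<noteq> {}"
  then obtain s where s: "\<omega>' \<in> ends (del_verts G D)" "s \<in> \<omega>'" "s \<in> \<omega>" by blast
  have sG: "simple_graph (del_verts G D)" by (rule simple_graph_del_verts[OF G(1)])
  have "range s \<inter> D = {}" using end_ray[OF sG s(1,2)] by (simp add: is_ray_del_verts)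
  then have s': "s \<in> end_minus G D \<omega>" using s(3) by (simp add: end_minus_def)
  show "\<omega>' = end_minus G D \<omega>"
  proof (intro equalityI subsetI)
    fix t assume "t \<in> \<omega>'"
    then show "t \<in> end_minus G D \<omega>"
      using end_ray[OF sG s(1)] end_live[OF sG s(1) _ s(2)] by (intro end_memI[OF sG end_minus_end s']) auto
  next
    fix t assume "t \<in> end_minus G D \<omega>"
    then show "t \<in> \<omega>'"
      using end_ray[OF sG end_minus_end] end_live[OF sG end_minus_end _ s']
      by (intro end_memI[OF sG s(1,2)]) auto
  qed
qed

lemma contains_ray_of_del_verts: "contains_ray_of (del_verts G D) \<omega>"
  using ray_outside end_ray[OF G] by (auto simp: contains_ray_of_def is_ray_del_verts end_minus_def)

text \<open>A fan in \<open>G - D\<close> is also a fan in \<open>G\<close>. For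
  \<open>D = Dom G \<omega>\<close> the induced end is therefore undominated, as
  \<open>regions_to_exists\<close> requires.\<close>

lemma Dom_end_minus: "Dom (del_verts G D) (end_minus G D \<omega>) \<subseteq> Dom G \<omega> - D"
proof
  fix v assume "v \<in> Dom (del_verts G D) (end_minus G D \<omega>)"
  then obtain r where r: "v \<in> verts G - D" "r \<in> \<omega>" "dominates_ray (del_verts G D) v r"
    by (auto simp: Dom_def end_minus_def)
  have path: "is_path (del_verts G D) p \<Longrightarrow> is_path G p" for p by (erule is_path_mono) auto
  have "dominates_ray G v r"
  proof -
    obtain PP where PP: "infinite PP"
      "\<forall>p\<in>PP. is_path (del_verts G D) p \<and> hd p = v \<and> set p \<inter> range r = {last p}"
      "\<forall>p\<in>PP. \<forall>q\<in>PP. p \<noteq> q \<longrightarrow> set p \<inter> set q = {v}"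
      using r(3) unfolding dominates_ray_def by (elim exE conjE)
    then have "\<forall>p\<in>PP. is_path G p \<and> hd p = v \<and> set p \<inter> range r = {last p}" using path by simp
    with PP show ?thesis unfolding dominates_ray_def by (intro exI[of _ PP] conjI)
  qed
  then show "v \<in> Dom G \<omega> - D" using r by (auto simp: Dom_def)
qed

end

text \<open>The edge boundary may be infinite, whereas the final subgraph has to be finite; so
  finitely many edges realising the ratio are extracted. The map \<open>f\<close> forgets the
  orientation of an edge.\<close>

lemma finite_subset_of_ratio:
  assumes f: "A = f ` P" and gt: "ereal m < ecard A / ecard B" and B: "finite B" "B \<noteq> {}"
  shows "\<exists>E. finite E \<and> E \<subseteq> P \<and> m * real (card B) \<le> real (card E)"
proof -
  obtain A0 where A0: "finite A0" "A0 \<subseteq> A" "m * real (card B) \<le> real (card A0)"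
  proof (cases "finite A")
    case True
    have "card B > 0" using B by (simp add: card_gt_0_iff)
    then have "m < real (card A) / real (card B)" using gt True B by (simp add: ecard_def)
    then have "m * real (card B) \<le> real (card A)" using \<open>card B > 0\<close> by (simp add: field_simps)
    then show ?thesis using that[of A] True by simp
  next
    case False
    obtain n :: nat where n: "m * real (card B) \<le> real n" using real_arch_simple by blast
    obtain A0 where "A0 \<subseteq> A" "finite A0" "card A0 = n" using infinite_arbitrarily_large[OF False] by blast
    then show ?thesis using that[of A0] n by simp
  qed
  then obtain E where E: "E \<subseteq> P" "finite E" "A0 = f ` E" using f finite_subset_image[of A0 f P] by blast
  then have "card A0 \<le> card E" by (simp add: card_image_le)
  then have "m * real (card B) \<le> real (card E)" using A0(3) by linarith
  then show ?thesis using E by blast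
qed

text \<open>What is kept of a region of \<open>G - D\<close> with vertex set \<open>H\<close> and
  boundary \<open>B\<close>, now seen inside \<open>G\<close>: an interior vertex can have
  neighbours outside \<open>H\<close> only in the deleted set \<open>D\<close>.\<close>

definition pocket :: "'a graph \<Rightarrow> 'a set \<Rightarrow> 'a set \<Rightarrow> 'a set \<Rightarrow> bool" where
  "pocket G H B D \<longleftrightarrow> H \<subseteq> verts G \<and> B \<subseteq> H \<and> finite B \<and> finite D \<and> D \<inter> H = {}
    \<and> (\<forall>u\<in>H. \<forall>v\<in>H. joined G H u v)
    \<and> (\<forall>u\<in>H - B. \<forall>w. {u, w} \<in> edges G \<longrightarrow> w \<in> H \<union> D)"

text \<open>The edges are oriented pairs starting in the boundary, so that \<open>E\<close> bounds a
  sum of degrees over \<open>B\<close> from below.\<close>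

definition ratio_pocket ::
    "'a graph \<Rightarrow> real \<Rightarrow> (nat \<Rightarrow> 'a) set \<Rightarrow> 'a set \<Rightarrow> 'a set \<Rightarrow> 'a set \<Rightarrow> bool" where
  "ratio_pocket G m \<omega> H B D \<longleftrightarrow> pocket G H B D \<and> B \<noteq> {} \<and> (\<exists>r\<in>\<omega>. range r \<subseteq> H)
    \<and> (\<exists>E. finite E \<and> E \<subseteq> {(u, w). u \<in> B \<and> w \<in> verts G - D - H \<and> {u, w} \<in> edges G}
        \<and> m * real (card B) \<le> real (card E))"

text \<open>The infimum bounds the limit inferior of every convergent sequence, in particular of one
  whose regions all avoid \<open>Y\<close>; some region of that sequence has a large ratio.\<close>

lemma ratio_region:
  assumes G: "simple_graph G" "\<omega> \<in> ends G" and D: "finite (Dom G \<omega>)"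
    and deg: "ereal x \<le> rel_degree G \<omega>" and m: "m + real (card (Dom G \<omega>)) < x" and Y: "finite Y"
  shows "\<exists>H B. H \<inter> Y = {} \<and> ratio_pocket G m \<omega> H B (Dom G \<omega>)"
proof -
  let ?D = "Dom G \<omega>" and ?G = "del_verts G (Dom G \<omega>)" and ?\<omega> = "end_minus G (Dom G \<omega>) \<omega>"
  let ?ratio = "\<lambda>H i. ecard (edge_boundary ?G (H i)) / ecard (vert_boundary ?G (H i))"
  have G': "simple_graph ?G" "?\<omega> \<in> ends ?G"
    using simple_graph_del_verts[OF G(1)] end_minus_end[OF G D] by auto
  have "Dom ?G ?\<omega> = {}" using Dom_end_minus[OF G D] by blast
  then obtain H where H: "regions_to ?G H ?\<omega>"
    "\<forall>i. verts (H i) \<inter> Y = {} \<and> vert_boundary ?G (H i) \<noteq> {}"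
    using regions_to_exists[OF G' _ Y] by blast
  have "rel_degree G \<omega> = ecard ?D + (INF H \<in> {H. regions_to ?G H ?\<omega>}. liminf (?ratio H))"
    unfolding rel_degree_def Let_def end_minus_unique[OF G D]
    using contains_ray_of_del_verts[OF G D] D by simp
  also have "\<dots> \<le> ecard ?D + liminf (?ratio H)"
    using H(1) by (intro add_left_mono INF_lower) simp
  finally have "ereal x \<le> ereal (real (card ?D)) + liminf (?ratio H)"
    using deg D by (simp add: ecard_def)
  \<comment> \<open>The finite number of dominating vertices is subtracted on both sides; strictness
    here makes the ratio exceed \<open>m\<close> for all late indices.\<close>
  then have "ereal m < liminf (?ratio H)"
    using m by (cases "liminf (?ratio H)") auto
  then have "eventually (\<lambda>i. ereal m < ?ratio H i) sequentially" by (rule less_LiminfD)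
  then obtain i where i: "ereal m < ?ratio H i" by (auto simp: eventually_sequentially)
  have reg: "is_region ?G ?\<omega> (H i)" using H(1) by (simp add: regions_to_def)
  let ?H = "verts (H i)" and ?B = "vert_boundary ?G (H i)"
  let ?P = "{(u, w). u \<in> ?B \<and> w \<in> verts G - ?D - ?H \<and> {u, w} \<in> edges G}"
  have HV: "?H \<subseteq> verts ?G" "H i = induced ?G ?H" "connected_graph (H i)" "finite ?B"
    using reg by (auto simp: is_region_def subgraph_def)
  have BH: "?B \<subseteq> ?H" by (auto simp: vert_boundary_def)
  have "edge_boundary ?G (H i) = (\<lambda>(u, w). {u, w}) ` ?P"
    using HV(1) unfolding edge_boundary_def vert_boundary_def by (auto simp: image_iff)
  from finite_subset_of_ratio[OF this i HV(4)] H(2)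
  obtain E where E: "finite E" "E \<subseteq> ?P" "m * real (card ?B) \<le> real (card E)" by blast
  have jH: "joined G ?H u v" if "u \<in> ?H" "v \<in> ?H" for u v
  proof -
    have "joined ?G ?H u v" using connected_induced_iff[OF HV(1)] HV(2,3) that by simp
    then show ?thesis by (rule joined_mono_graph) auto
  qed
  have nbr: "w \<in> ?H \<union> ?D" if "u \<in> ?H - ?B" "{u, w} \<in> edges G" for u w
    using that HV(1) simple_graph_edgeD[OF G(1) that(2)] by (auto simp: vert_boundary_def)
  have "pocket G ?H ?B ?D"
    unfolding pocket_def using HV(1) by (intro conjI ballI allI impI jH nbr BH HV(4) D) auto
  moreover obtain r where "r \<in> ?\<omega>" "is_ray (H i) r" using reg by (auto simp: is_region_def contains_ray_of_def)
  then have "\<exists>r\<in>\<omega>. range r \<subseteq> ?H" by (auto simp: end_minus_def is_ray_def)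
  ultimately have "ratio_pocket G m \<omega> ?H ?B ?D"
    unfolding ratio_pocket_def using E H(2) by blast
  then show ?thesis using H(2) by blast
qed

subsection \<open>Disjoint pockets around all ends\<close>

lemma pocket_nbr:
  "pocket G H B D \<Longrightarrow> u \<in> H \<Longrightarrow> u \<notin> B \<Longrightarrow> {u, w} \<in> edges G \<Longrightarrow> w \<in> H \<or> w \<in> D"
  by (auto simp: pocket_def)

lemma pocket_empty: "pocket G {} {} {}"
  by (simp add: pocket_def)

text \<open>The interior is closed under edges of \<open>G - (B \<union> D)\<close>, and
  \<open>B \<union> D\<close> is finite. So the end lives in the interior, and all its rays end up
  there.\<close>

lemma pocket_tail:
  assumes P: "pocket G H B D" and G: "simple_graph G" "\<omega> \<in> ends G"
    and r: "r \<in> \<omega>" "range r \<subseteq> H" and s: "s \<in> \<omega>"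
  shows "\<exists>n. \<forall>i\<ge>n. s i \<in> H - B"
proof -
  let ?X = "B \<union> D"
  have X: "finite ?X" using P by (simp add: pocket_def)
  have ray: "is_ray G r" "is_ray G s" using end_ray[OF G] r s by auto
  obtain n where n: "\<forall>i\<ge>n. r i \<notin> ?X" using ray_avoids[OF ray(1) X] by blast
  have "live G ?X r \<subseteq> H - B"
  proof (rule live_closed[OF ray(1) X])
    have "r (max n m) \<in> H - B" for m using n r(2) by auto
    then show "\<exists>i\<ge>m. r i \<in> H - B" for m using max.cobounded2 by blast
    show "y \<in> H - B" if "x \<in> H - B" "y \<in> verts G - ?X" "{x, y} \<in> edges G" for x y
      using pocket_nbr[OF P, of x y] that by auto
  qed
  moreover have "live G ?X s = live G ?X r" by (rule end_live[OF G s r(1) X])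
  ultimately show ?thesis using live_tail[OF ray(2) X] by blast
qed

text \<open>Only finitely many of the disjoint paths from \<open>d\<close> towards the end can enter a pocket in which the
  end does not live, since such a path has to leave it again through \<open>B i\<close> or \<open>D i\<close>.\<close>

lemma dominator_infinite_nbrs:
  assumes G: "simple_graph G" "\<omega> \<in> ends G" and d: "d \<in> Dom G \<omega>" and I: "finite I"
    and P: "\<And>i. i \<in> I \<Longrightarrow> pocket G (H i) (B i) (D i)"
    and no: "\<And>i. i \<in> I \<Longrightarrow> \<not> (\<exists>r\<in>\<omega>. range r \<subseteq> H i)"
  shows "infinite (nbrs G d - (\<Union>i\<in>I. H i - B i))"
proof
  assume fin: "finite (nbrs G d - (\<Union>i\<in>I. H i - B i))" (is "finite ?N")
  \<comment> \<open>Once \<open>X\<close> is deleted, every edge at \<open>d\<close> leads into an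
    interior, and an interior can be left only through \<open>d\<close>.\<close>
  define X where "X = ((\<Union>i\<in>I. B i \<union> D i) \<union> ?N) - {d}"
  let ?A = "insert d (\<Union>i\<in>I. H i - B i)"
  have X: "finite X" "d \<notin> X" using fin I P by (auto simp: X_def pocket_def)
  obtain r where r: "r \<in> \<omega>" using end_nonempty[OF G] by blast
  have ray: "is_ray G r" using end_ray[OF G r] .
  obtain n where n: "\<forall>j\<ge>n. joined G (verts G - X) d (r j)"
    using Dom_live[OF G d r X] by (auto simp: live_def)
  obtain n' where n': "\<forall>j\<ge>n'. r j \<notin> insert d X" using ray_avoids[OF ray, of "insert d X"] X by auto
  have A: "r j \<in> ?A" if "j \<ge> n" for j
  proof (rule joined_closed)
    show "joined G (verts G - X) d (r j)" using n that by simp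
    fix x y assume xy: "x \<in> ?A" "y \<in> verts G - X" "{x, y} \<in> edges G"
    show "y \<in> ?A"
    proof (cases "x = d")
      case True
      then have "y \<in> nbrs G d" using xy by (simp add: nbrs_def)
      then show ?thesis using xy(2) by (auto simp: X_def)
    next
      case False
      then obtain i where i: "i \<in> I" "x \<in> H i" "x \<notin> B i" using xy(1) by blast
      have "y \<in> H i \<or> y \<in> D i" using pocket_nbr[OF P[OF i(1)] i(2,3) xy(3)] .
      moreover have "y = d \<or> y \<notin> B i \<union> D i" using xy(2) i(1) by (auto simp: X_def)
      ultimately show ?thesis using i(1) by blast
    qed
  qed simp
  define j0 where "j0 = max n n'"
  have "r j0 \<in> ?A" "r j0 \<noteq> d" using A[of j0] n'[rule_format, of j0] by (simp_all add: j0_def)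
  then obtain i where i: "i \<in> I" "r j0 \<in> H i" "r j0 \<notin> B i" by blast
  \<comment> \<open>Leaving the interior would use a vertex of \<open>B i\<close> or
    \<open>D i\<close>, that is, of \<open>X\<close> or \<open>d\<close> itself; from
    \<open>j0\<close> on the ray avoids these.\<close>
  have step: "r j \<in> H i \<and> r j \<notin> B i" if "j \<ge> j0" for j
    using that
  proof (induction rule: dec_induct)
    case base then show ?case using i by simp
  next
    case (step j)
    have "{r j, r (Suc j)} \<in> edges G" using ray by (simp add: is_ray_def)
    then have "r (Suc j) \<in> H i \<or> r (Suc j) \<in> D i" using pocket_nbr[OF P[OF i(1)]] step.IH by blast
    moreover have "r (Suc j) \<notin> insert d X" using n' step.hyps by (auto simp: j0_def)
    then have "r (Suc j) \<notin> B i \<union> D i" using i(1) by (auto simp: X_def)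
    ultimately show ?case by blast
  qed
  then have "range (ray_tail j0 r) \<subseteq> H i" by (auto simp: ray_tail_def)
  then show False using no[OF i(1)] end_ray_tail[OF G r] by blast
qed

text \<open>The \<open>n\<close>-th pocket captures the end \<open>e n\<close> and is empty when an earlier one already does. The
  finite sets \<open>Q n\<close> reserve neighbours of the dominating vertices \<open>D n\<close> outside all the pockets.\<close>

definition stage where
  "stage G m M e H B D Q (n :: nat) h b d q \<longleftrightarrow>
    pocket G h b d \<and> (h \<noteq> {} \<longrightarrow> b \<noteq> {})
    \<and> (\<exists>E. finite E \<and> E \<subseteq> {(u, w). u \<in> b \<and> w \<in> verts G - d - h \<and> {u, w} \<in> edges G}
        \<and> m * real (card b) \<le> real (card E))
    \<and> (\<forall>i. i < n \<longrightarrow> h \<inter> (H i \<union> D i \<union> Q i) = {})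
    \<and> h \<inter> q = {} \<and> finite q \<and> q \<subseteq> verts G \<and> (\<forall>i. i < n \<longrightarrow> q \<inter> (H i - B i) = {})
    \<and> (\<forall>x\<in>d. M * (1 + (\<Sum>i<n. card (B i))) \<le> card (q \<inter> nbrs G x))
    \<and> (e n \<in> ends G \<longrightarrow> (\<exists>r\<in>e n. range r \<subseteq> h) \<or> (\<exists>i. i < n \<and> (\<exists>r\<in>e n. range r \<subseteq> H i)))"

text \<open>A stage inspects only earlier values, which is the congruence condition of
  \<open>dependent_wf_choice\<close>.\<close>

lemma stage_cong:
  assumes "\<And>i. i < n \<Longrightarrow> H i = H' i" "\<And>i. i < n \<Longrightarrow> B i = B' i"
    "\<And>i. i < n \<Longrightarrow> D i = D' i" "\<And>i. i < n \<Longrightarrow> Q i = Q' i"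
  shows "stage G m M e H B D Q n h b d q = stage G m M e H' B' D' Q' n h b d q"
proof -
  have "(\<Sum>i<n. card (B i)) = (\<Sum>i<n. card (B' i))" using assms by (intro sum.cong) auto
  then show ?thesis unfolding stage_def by (simp add: assms cong: conj_cong)
qed

text \<open>The reserved set \<open>q\<close> is chosen before the pocket: infinitely many
  neighbours of a dominating vertex avoid the earlier interiors, and the new pocket can then be made
  to avoid the finite set \<open>q\<close>.\<close>

lemma stage_exists:
  fixes M :: nat
  assumes G: "simple_graph G" and D: "\<And>\<omega>. \<omega> \<in> ends G \<Longrightarrow> finite (Dom G \<omega>)"
    and ratio: "\<And>\<omega> Y. \<omega> \<in> ends G \<Longrightarrow> finite Y \<Longrightarrow> \<exists>h b. h \<inter> Y = {} \<and> ratio_pocket G m \<omega> h b (Dom G \<omega>)"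
    and prev: "\<And>i. i < n \<Longrightarrow> stage G m M e H B D Q i (H i) (B i) (D i) (Q i)"
  shows "\<exists>h b d q. stage G m M e H B D Q n h b d q"
proof (cases "e n \<in> ends G \<and> \<not> (\<exists>i. i < n \<and> (\<exists>r\<in>e n. range r \<subseteq> H i))")
  case False
  \<comment> \<open>With empty \<open>d\<close> nothing has to be reserved, and the capture clause
    holds by the case assumption.\<close>
  then have "stage G m M e H B D Q n {} {} {} {}" by (auto simp: stage_def pocket_empty)
  then show ?thesis by blast
next
  case True
  let ?\<omega> = "e n" and ?d = "Dom G (e n)" and ?N = "M * (1 + (\<Sum>i<n. card (B i)))"
  have \<omega>: "?\<omega> \<in> ends G" using True by simp
  have P: "pocket G (H i) (B i) (D i)" if "i < n" for i using prev[OF that] by (simp add: stage_def)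
  have fQ: "finite (Q i)" if "i < n" for i using prev[OF that] by (simp add: stage_def)
  have "\<exists>A. A \<subseteq> nbrs G x - (\<Union>i\<in>{..<n}. H i - B i) \<and> finite A \<and> card A = ?N" if "x \<in> ?d" for x
  proof -
    have "infinite (nbrs G x - (\<Union>i\<in>{..<n}. H i - B i))"
    proof (rule dominator_infinite_nbrs[OF G \<omega> that])
      show "pocket G (H i) (B i) (D i)" if "i \<in> {..<n}" for i using P that by simp
      show "\<not> (\<exists>r\<in>e n. range r \<subseteq> H i)" if "i \<in> {..<n}" for i using True that by simp
    qed simp
    from infinite_arbitrarily_large[OF this] show ?thesis by metis
  qed
  then have "\<forall>x\<in>?d. \<exists>A. A \<subseteq> nbrs G x - (\<Union>i\<in>{..<n}. H i - B i) \<and> finite A \<and> card A = ?N"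
    by blast
  then obtain A where A: "\<forall>x\<in>?d. A x \<subseteq> nbrs G x - (\<Union>i\<in>{..<n}. H i - B i) \<and> finite (A x) \<and> card (A x) = ?N"
    by (elim bchoice[THEN exE])
  define q where "q = (\<Union>x\<in>?d. A x)"
  have q: "finite q" "q \<subseteq> verts G" "\<And>i. i < n \<Longrightarrow> q \<inter> (H i - B i) = {}"
    using A D[OF \<omega>] by (auto simp: q_def nbrs_def)
  have qc: "?N \<le> card (q \<inter> nbrs G x)" if "x \<in> ?d" for x
  proof -
    have "A x \<subseteq> q \<inter> nbrs G x" "card (A x) = ?N" using A that by (auto simp: q_def)
    then show ?thesis using card_mono[of "q \<inter> nbrs G x" "A x"] q(1) by simp
  qed
  \<comment> \<open>The earlier pockets may be infinite and cannot be put into \<open>Y\<close>;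
    avoiding the finite sets \<open>B i\<close> and \<open>D i\<close> suffices. A connected set
    that misses both and meets \<open>H i\<close> is contained in \<open>H i\<close>, which would
    then already capture the end.\<close>
  define Y where "Y = q \<union> (\<Union>i<n. B i \<union> D i \<union> Q i)"
  have "finite Y" using q(1) P fQ by (auto simp: Y_def pocket_def)
  then obtain h b where hb: "h \<inter> Y = {}" "ratio_pocket G m ?\<omega> h b ?d" using ratio[OF \<omega>] by blast
  have ph: "pocket G h b ?d" using hb(2) by (simp add: ratio_pocket_def)
  have disj: "h \<inter> H i = {}" if i: "i < n" for i
  proof (rule ccontr)
    assume "h \<inter> H i \<noteq> {}"
    then obtain x where x: "x \<in> h" "x \<in> H i" by blast
    have hY: "y \<notin> B i" "y \<notin> D i" if "y \<in> h" for y using hb(1) that i by (auto simp: Y_def)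
    have "y \<in> H i - B i" if "y \<in> h" for y
    proof (rule joined_closed)
      show "joined G h x y" using ph x(1) that by (simp add: pocket_def)
      show "x \<in> H i - B i" using x hY by simp
      show "w \<in> H i - B i" if "z \<in> H i - B i" "w \<in> h" "{z, w} \<in> edges G" for z w
        using pocket_nbr[OF P[OF i], of z w] hY[OF that(2)] that by auto
    qed
    then have "h \<subseteq> H i" by blast
    moreover obtain r where "r \<in> ?\<omega>" "range r \<subseteq> h" using hb(2) by (auto simp: ratio_pocket_def)
    ultimately show False using True i by blast
  qed
  have hi: "h \<inter> (H i \<union> D i \<union> Q i) = {}" if "i < n" for i
    using disj[OF that] hb(1) that by (auto simp: Y_def)
  have hq: "h \<inter> q = {}" using hb(1) by (auto simp: Y_def)
  have hb': "b \<noteq> {}" "\<exists>r\<in>?\<omega>. range r \<subseteq> h"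
    "\<exists>E. finite E \<and> E \<subseteq> {(u, w). u \<in> b \<and> w \<in> verts G - ?d - h \<and> {u, w} \<in> edges G}
        \<and> m * real (card b) \<le> real (card E)"
    using hb(2) unfolding ratio_pocket_def by blast+
  have "stage G m M e H B D Q n h b ?d q"
    unfolding stage_def
    by (intro conjI allI impI ballI ph hb' hi hq q qc disjI1)
  then show ?thesis by blast
qed

text \<open>Each choice depends on all earlier ones and not just on the last, so it is made along
  the well-founded order, with the four components packed into a tuple.\<close>

lemma stages_exist:
  fixes M :: nat
  assumes G: "simple_graph G" and D: "\<And>\<omega>. \<omega> \<in> ends G \<Longrightarrow> finite (Dom G \<omega>)"
    and ratio: "\<And>\<omega> Y. \<omega> \<in> ends G \<Longrightarrow> finite Y \<Longrightarrow> \<exists>h b. h \<inter> Y = {} \<and> ratio_pocket G m \<omega> h b (Dom G \<omega>)"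
  shows "\<exists>H B D Q. \<forall>n. stage G m M e H B D Q n (H n) (B n) (D n) (Q n)"
proof -
  let ?P = "\<lambda>f (n::nat) t. stage G m M e (\<lambda>i. fst (f i)) (\<lambda>i. fst (snd (f i))) (\<lambda>i. fst (snd (snd (f i))))
      (\<lambda>i. snd (snd (snd (f i)))) n (fst t) (fst (snd t)) (fst (snd (snd t))) (snd (snd (snd t)))"
  have "\<exists>f. \<forall>n::nat. ?P f n (f n)"
  proof (rule dependent_wf_choice[of less_than ?P])
    show "?P f n t = ?P g n t" if "\<And>z. (z, n) \<in> less_than \<Longrightarrow> f z = g z" for f g n t
      using that by (intro stage_cong) auto
    show "\<exists>t. ?P f n t" if prev: "\<And>i. (i, n) \<in> less_than \<Longrightarrow> ?P f i (f i)" for n f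
    proof -
      obtain h b d q where "stage G m M e (\<lambda>i. fst (f i)) (\<lambda>i. fst (snd (f i))) (\<lambda>i. fst (snd (snd (f i))))
        (\<lambda>i. snd (snd (snd (f i)))) n h b d q"
        using stage_exists[OF G D ratio, of n M e "\<lambda>i. fst (f i)" "\<lambda>i. fst (snd (f i))"
            "\<lambda>i. fst (snd (snd (f i)))" "\<lambda>i. snd (snd (snd (f i)))"] prev by auto
      then show ?thesis by (intro exI[of _ "(h, b, d, q)"]) simp
    qed
  qed simp
  then show ?thesis by blast
qed

subsection \<open>Koenig's lemma\<close>

text \<open>The sequence follows vertices with infinitely many continuations along shortest walks
  from \<open>v0\<close>. Its \<open>n\<close>-th vertex has distance \<open>n\<close>, which yields
  injectivity at once.\<close>

lemma koenig:
  assumes fin: "\<And>v. finite {w. R v w}" and inf: "infinite {w. R\<^sup>*\<^sup>* v0 w}"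
  shows "\<exists>f :: nat \<Rightarrow> 'a. inj f \<and> f 0 = v0 \<and> (\<forall>i. R (f i) (f (Suc i)))"
proof -
  define d where "d w = (LEAST n. (R ^^ n) v0 w)" for w
  have d: "(R ^^ d w) v0 w" if "R\<^sup>*\<^sup>* v0 w" for w
    using that unfolding d_def rtranclp_power by (auto intro: LeastI)
  have dle: "d w \<le> n" if "(R ^^ n) v0 w" for w n using that unfolding d_def by (rule Least_le)
  \<comment> \<open>The vertices that have a shortest walk from \<open>v0\<close> passing through
    \<open>v\<close>. Apart from \<open>v\<close> itself they are distributed over the finitely many
    successors of \<open>v\<close> one step further away.\<close>
  define geo where "geo v = {w. R\<^sup>*\<^sup>* v0 w \<and> (\<exists>j. (R ^^ j) v w \<and> d w = d v + j)}" for v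
  have d0: "d v0 = 0" using dle[of 0 v0] by simp
  have step: "\<exists>u. R v u \<and> R\<^sup>*\<^sup>* v0 u \<and> d u = Suc (d v) \<and> infinite (geo u)"
    if v: "R\<^sup>*\<^sup>* v0 v" "infinite (geo v)" for v
  proof (rule ccontr)
    assume no: "\<not> ?thesis"
    let ?N = "{u. R v u \<and> d u = Suc (d v)}"
    have "geo v \<subseteq> insert v (\<Union>u\<in>?N. geo u)"
    proof
      fix w assume "w \<in> geo v"
      then obtain j where w: "R\<^sup>*\<^sup>* v0 w" "(R ^^ j) v w" "d w = d v + j" by (auto simp: geo_def)
      show "w \<in> insert v (\<Union>u\<in>?N. geo u)"
      proof (cases j)
        case 0 then show ?thesis using w by simp
      next
        case (Suc i)
        then obtain u where u: "R v u" "(R ^^ i) u w" using w(2) by (metis relpowp_Suc_D2)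
        have v0u: "(R ^^ Suc (d v)) v0 u" using d[OF v(1)] u(1) by auto
        then have "d u \<le> Suc (d v)" by (rule dle)
        moreover have "R\<^sup>*\<^sup>* v0 u" using v(1) u(1) by auto
        then have "(R ^^ (d u + i)) v0 w" using d u(2) by (auto simp: relpowp_add)
        then have "d w \<le> d u + i" by (rule dle)
        ultimately have "d u = Suc (d v)" using w(3) Suc by simp
        then have "w \<in> geo u" using w u Suc by (auto simp: geo_def)
        then show ?thesis using u(1) \<open>d u = Suc (d v)\<close> by blast
      qed
    qed
    moreover have "finite ?N" using fin[of v] by (rule rev_finite_subset) auto
    moreover have "finite (geo u)" if "u \<in> ?N" for u
    proof -
      have "R\<^sup>*\<^sup>* v0 u" using v(1) that by auto
      then show ?thesis using no that by auto
    qed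
    then have "finite (insert v (\<Union>u\<in>?N. geo u))" using \<open>finite ?N\<close> by simp
    ultimately show False using v(2) finite_subset by blast
  qed
  have "geo v0 = {w. R\<^sup>*\<^sup>* v0 w}" using d by (auto simp: geo_def d0)
  then have "infinite (geo v0)" using inf by simp
  let ?P = "\<lambda>(n::nat) v. R\<^sup>*\<^sup>* v0 v \<and> d v = n \<and> infinite (geo v)"
  have "\<exists>f. \<forall>n. ?P n (f n) \<and> R (f n) (f (Suc n))"
  proof (rule dependent_nat_choice)
    show "\<exists>v. ?P 0 v" using \<open>infinite (geo v0)\<close> d0 by blast
    show "\<exists>u. ?P (Suc n) u \<and> R v u" if "?P n v" for v n using step[of v] that by auto
  qed
  then obtain f where f: "\<forall>n. ?P n (f n) \<and> R (f n) (f (Suc n))" by blast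
  have "inj f" by (rule injI) (metis f)
  moreover have "f 0 = v0" using d[of "f 0"] f by auto
  ultimately show ?thesis using f by blast
qed

subsection \<open>A finite subgraph of large average degree\<close>

text \<open>The union of paths inside \<open>H\<close> from one fixed vertex of \<open>B\<close> to
  all vertices of \<open>B\<close>.\<close>

lemma finite_connector:
  assumes "H \<subseteq> verts G" "B \<subseteq> H" "finite B" "\<And>u v. u \<in> H \<Longrightarrow> v \<in> H \<Longrightarrow> joined G H u v"
  shows "\<exists>S. finite S \<and> B \<subseteq> S \<and> S \<subseteq> H \<and> (\<forall>u\<in>S. \<forall>v\<in>S. joined G S u v)"
proof (cases "B = {}")
  case True then show ?thesis by (intro exI[of _ "{}"]) simp
next
  case False
  then obtain a where a: "a \<in> B" by blast
  have "\<forall>b\<in>B. \<exists>p. is_path G p \<and> set p \<subseteq> H \<and> hd p = a \<and> last p = b"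
    using path_of_joined[OF assms(4) assms(1)] a assms(2) by (meson subsetD)
  then obtain p where p: "\<forall>b\<in>B. is_path G (p b) \<and> set (p b) \<subseteq> H \<and> hd (p b) = a \<and> last (p b) = b"
    by (elim bchoice[THEN exE])
  define S where "S = (\<Union>b\<in>B. set (p b))"
  have aS: "joined G S a w" if "w \<in> S" for w
  proof -
    obtain b where b: "b \<in> B" "w \<in> set (p b)" using \<open>w \<in> S\<close> by (auto simp: S_def)
    then have "joined G (set (p b)) a w" using joined_hd_path[of G "p b" w] p by simp
    then show ?thesis by (rule joined_mono) (use b in \<open>auto simp: S_def\<close>)
  qed
  have "b \<in> S" if "b \<in> B" for b
  proof -
    have "last (p b) \<in> set (p b)" using p that by (metis is_path_def last_in_set)
    then show ?thesis using p that by (auto simp: S_def)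
  qed
  moreover have "joined G S u v" if "u \<in> S" "v \<in> S" for u v
    using joined_trans[OF joined_sym[OF aS[OF that(1)]] aS[OF that(2)]] .
  moreover have "finite S" "S \<subseteq> H" using p assms(3) by (auto simp: S_def)
  ultimately show ?thesis by blast
qed

text \<open>The finite sets in \<open>deg\<close> also cover vertices of infinite degree;
  \<open>M\<close> is an integer bound because reserved neighbours are counted in
  \<open>nat\<close>.\<close>

locale pocket_system =
  fixes G :: "'a graph" and m :: real and M :: nat and e :: "nat \<Rightarrow> (nat \<Rightarrow> 'a) set"
    and H B D Q :: "nat \<Rightarrow> 'a set"
  assumes G: "simple_graph G" "verts G \<noteq> {}"
    and stage: "\<And>n. stage G m M e H B D Q n (H n) (B n) (D n) (Q n)"
    and enum: "\<And>\<omega>. \<omega> \<in> ends G \<Longrightarrow> \<exists>n. e n = \<omega>"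
    and deg: "\<And>v. v \<in> verts G \<Longrightarrow> \<exists>T. finite T \<and> T \<subseteq> nbrs G v \<and> m \<le> real (card T)"
    and M: "m \<le> real M"
begin

section \<open>Blocks and the edges they send into \<open>U\<close>\<close>

definition U :: "'a set" where "U = verts G - (\<Union>n. H n - B n)"

definition block :: "'a \<Rightarrow> 'a set" where "block v = insert v (\<Union>n\<in>{n. v \<in> B n}. B n)"

lemma pocket: "pocket G (H n) (B n) (D n)"
  using stage[of n] by (simp add: stage_def)

lemma BH: "B n \<subseteq> H n" and HV: "H n \<subseteq> verts G" and finB: "finite (B n)"
  using pocket[of n] by (auto simp: pocket_def)

lemma H_disjoint_less: "i < n \<Longrightarrow> H n \<inter> H i = {}" "i < n \<Longrightarrow> H n \<inter> D i = {}" "i \<le> n \<Longrightarrow> H n \<inter> Q i = {}"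
  using stage[of n] by (auto simp: stage_def le_less)

lemma H_disjoint: "i \<noteq> n \<Longrightarrow> H n \<inter> H i = {}"
  using H_disjoint_less(1)[of i n] H_disjoint_less(1)[of n i] by (cases "i < n") auto

lemma H_unique: "v \<in> H n \<Longrightarrow> v \<in> H i \<Longrightarrow> i = n"
  using H_disjoint by blast

text \<open>Earlier interiors were avoided when \<open>Q n\<close> was chosen; pocket
  \<open>n\<close> and all later ones were chosen to avoid \<open>Q n\<close>.\<close>

lemma QU: "Q n \<subseteq> U"
proof -
  have "Q n \<inter> (H i - B i) = {}" for i
  proof (cases "i < n")
    case True then show ?thesis using stage[of n] by (simp add: stage_def)
  next
    case False then show ?thesis using H_disjoint_less(3)[of n i] by auto
  qed
  moreover have "Q n \<subseteq> verts G" using stage[of n] by (simp add: stage_def)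
  ultimately show ?thesis by (auto simp: U_def)
qed

lemma finQ: "finite (Q n)"
  using stage[of n] by (simp add: stage_def)

lemma cardQ: "d \<in> D n \<Longrightarrow> M * (1 + (\<Sum>i<n. card (B i))) \<le> card (Q n \<inter> nbrs G d)"
  using stage[of n] by (simp add: stage_def)

lemma BU: "B n \<subseteq> U"
proof
  fix v assume v: "v \<in> B n"
  then have "v \<notin> H i - B i" for i using H_unique[of v n i] BH[of n] by auto
  then show "v \<in> U" using v BH[of n] HV[of n] by (auto simp: U_def)
qed

lemma UV: "U \<subseteq> verts G"
  by (auto simp: U_def)

text \<open>If all of \<open>G\<close> were swallowed by pockets, a nonempty pocket would still
  contribute its nonempty boundary.\<close>

lemma U_nonempty: "\<exists>v. v \<in> U"
proof -
  obtain v where v: "v \<in> verts G" using G(2) by blast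
  show ?thesis
  proof (cases "v \<in> U")
    case False
    then obtain n where "v \<in> H n" using v by (auto simp: U_def)
    then have "B n \<noteq> {}" using stage[of n] by (auto simp: stage_def)
    then show ?thesis using BU[of n] by blast
  qed blast
qed

lemma block_B: "v \<in> B n \<Longrightarrow> block v = B n"
proof -
  assume v: "v \<in> B n"
  then have "{i. v \<in> B i} = {n}" using H_unique BH by blast
  then show ?thesis using v by (auto simp: block_def)
qed

lemma block_single: "(\<And>n. v \<notin> B n) \<Longrightarrow> block v = {v}"
  by (simp add: block_def)

lemma block_cases:
  obtains n where "v \<in> B n" "block v = B n" | "\<And>n. v \<notin> B n" "block v = {v}"
  using block_B block_single by blast

lemma block_self: "v \<in> block v"
  by (simp add: block_def)

lemma block_eq: "u \<in> block v \<Longrightarrow> block u = block v"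
  by (cases v rule: block_cases) (auto dest: block_B)

text \<open>A finite set of out-neighbours of a block. Edges are counted from the side of
  \<open>b\<close>, so these bounds add up over disjoint blocks to a bound on a degree sum.\<close>

definition targets :: "'a set \<Rightarrow> 'a set \<Rightarrow> bool" where
  "targets b T \<longleftrightarrow> finite T \<and> T \<subseteq> U \<and> (\<forall>w\<in>T. \<exists>u\<in>b. {u, w} \<in> edges G)
    \<and> m * real (card b) \<le> real (\<Sum>u\<in>b. card (nbrs G u \<inter> T))"

text \<open>One dominating vertex \<open>d\<close> supplies the edges for its whole block from its
  reserved neighbours.\<close>

lemma targets_Q:
  assumes d: "d \<in> b" "d \<in> D i" and b: "finite b" and c: "card b \<le> 1 + (\<Sum>j<i. card (B j))"
  shows "targets b (Q i \<inter> nbrs G d)"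
proof -
  let ?T = "Q i \<inter> nbrs G d"
  have "m * real (card b) \<le> real (M * card b)" using M by (simp add: mult_right_mono)
  also have "M * card b \<le> card ?T" using cardQ[OF d(2)] c mult_le_mono2[OF c, of M] by linarith
  also have "card ?T = card (nbrs G d \<inter> ?T)" by (simp add: Int_left_commute Int_commute)
  also have "\<dots> \<le> (\<Sum>u\<in>b. card (nbrs G u \<inter> ?T))" using d(1) b by (intro member_le_sum) auto
  finally have "m * real (card b) \<le> real (\<Sum>u\<in>b. card (nbrs G u \<inter> ?T))" by simp
  then show ?thesis using finQ QU d(1) by (auto simp: targets_def nbrs_def)
qed

text \<open>The outer ends of the edges realising the ratio lie in \<open>U\<close>: an outer end in
  the interior of pocket \<open>i\<close> would force its neighbour in \<open>B n\<close> into
  \<open>H i\<close> or \<open>D i\<close>. The latter is excluded, and the former gives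
  \<open>i = n\<close>, although outer ends avoid \<open>H n\<close>.\<close>

lemma targets_boundary:
  assumes no: "\<And>i. B n \<inter> D i = {}" shows "\<exists>T. targets (B n) T"
proof -
  obtain E where E: "finite E" "E \<subseteq> {(u, w). u \<in> B n \<and> w \<in> verts G - D n - H n \<and> {u, w} \<in> edges G}"
    "m * real (card (B n)) \<le> real (card E)"
    using stage[of n] unfolding stage_def by (elim conjE exE)
  let ?T = "snd ` E"
  have "w \<in> U" if "w \<in> ?T" for w
  proof -
    obtain u where u: "u \<in> B n" "w \<in> verts G" "w \<notin> H n" "{u, w} \<in> edges G" using \<open>w \<in> ?T\<close> E(2) by auto
    have "w \<notin> H i - B i" for i
    proof
      assume w: "w \<in> H i - B i"
      then have "u \<in> H i \<or> u \<in> D i" using pocket_nbr[OF pocket, of w i u] u(4) by (simp add: insert_commute)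
      then have "u \<in> H i" using no[of i] u(1) by blast
      then have "i = n" using H_unique[of u n i] u(1) BH[of n] by blast
      then show False using w u(3) by simp
    qed
    then show ?thesis using u(2) by (simp add: U_def)
  qed
  moreover have "E \<subseteq> (SIGMA u:B n. nbrs G u \<inter> ?T)"
    using E(2) by (force simp: nbrs_def)
  then have "card E \<le> card (SIGMA u:B n. nbrs G u \<inter> ?T)"
    using E(1) finB by (intro card_mono) auto
  then have "card E \<le> (\<Sum>u\<in>B n. card (nbrs G u \<inter> ?T))"
    using E(1) finB by (simp add: card_SigmaI)
  then have "m * real (card (B n)) \<le> real (\<Sum>u\<in>B n. card (nbrs G u \<inter> ?T))"
    using E(3) by linarith
  moreover have "\<forall>w\<in>?T. \<exists>u\<in>B n. {u, w} \<in> edges G" using E(2) by force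
  ultimately have "targets (B n) ?T" unfolding targets_def using E(1) by blast
  then show ?thesis by blast
qed

text \<open>Three sources: reserved neighbours if the block meets some \<open>D i\<close>, otherwise
  the ratio for a boundary and the ordinary degree for a singleton.\<close>

lemma targets_exist:
  assumes v: "v \<in> U" shows "\<exists>T. targets (block v) T"
proof (cases v rule: block_cases)
  case (1 n)
  show ?thesis
  proof (cases "\<exists>i. B n \<inter> D i \<noteq> {}")
    case True
    then obtain i d where d: "d \<in> B n" "d \<in> D i" by blast
    have dH: "d \<in> H n" using d(1) BH by blast
    \<comment> \<open>Only a later \<open>i\<close> remains, so \<open>B n\<close> is one of the
      boundaries counted in the size of \<open>Q i\<close>.\<close>
    have "i \<noteq> n" using pocket[of n] dH d(2) by (auto simp: pocket_def)
    moreover have "\<not> i < n" using H_disjoint_less(2)[of i n] dH d(2) by blast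
    ultimately have "n < i" by simp
    then have "card (B n) \<le> (\<Sum>j<i. card (B j))" by (intro member_le_sum) auto
    then show ?thesis using targets_Q[OF d finB] 1(2) by auto
  next
    case False
    then show ?thesis using targets_boundary[of n] 1(2) by auto
  qed
next
  case 2
  have vH: "v \<notin> H i" for i using v 2(1) by (auto simp: U_def)
  show ?thesis
  proof (cases "\<exists>i. v \<in> D i")
    case True
    then obtain i where "v \<in> D i" by blast
    then show ?thesis using targets_Q[of v "{v}" i] 2(2) by auto
  next
    \<comment> \<open>A vertex in no pocket and in no \<open>D i\<close> has no neighbour in an
      interior, so none of its edges is lost in \<open>U\<close>.\<close>
    case False
    obtain T where T: "finite T" "T \<subseteq> nbrs G v" "m \<le> real (card T)" using deg[of v] v UV by blast
    have "w \<in> U" if "w \<in> T" for w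
    proof -
      have w: "w \<in> verts G" "{w, v} \<in> edges G" using that T(2) by (auto simp: nbrs_def insert_commute)
      have "w \<notin> H i - B i" for i
        using pocket_nbr[OF pocket, of w i v] w(2) vH False by blast
      then show ?thesis using w(1) by (simp add: U_def)
    qed
    moreover have "nbrs G v \<inter> T = T" using T(2) by blast
    ultimately have "targets {v} T" using T by (auto simp: targets_def nbrs_def)
    then show ?thesis using 2(2) by auto
  qed
qed

text \<open>The end of the ray occurs in the enumeration, so it is captured at its own stage or was
  captured earlier.\<close>

lemma ray_in_pocket:
  assumes r: "is_ray G r" shows "\<exists>j n. \<forall>i\<ge>n. r i \<in> H j - B j"
proof -
  obtain \<omega> where \<omega>: "\<omega> \<in> ends G" "r \<in> \<omega>" using ray_in_end[OF G(1) r] by blast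
  then obtain n where n: "e n = \<omega>" using enum by blast
  have "(\<exists>s\<in>\<omega>. range s \<subseteq> H n) \<or> (\<exists>i. i < n \<and> (\<exists>s\<in>\<omega>. range s \<subseteq> H i))"
    using stage[of n] n \<omega>(1) by (simp add: stage_def)
  then obtain j s where s: "s \<in> \<omega>" "range s \<subseteq> H j" by blast
  then show ?thesis using pocket_tail[OF pocket G(1) \<omega>(1) s \<omega>(2)] by blast
qed

text \<open>Every vertex of \<open>U\<close> points to finitely many vertices, and the parts of a block are linked through
  a finite connected subgraph of its pocket. A ray following these pointers would have a tail inside
  one pocket, hence inside a finite connector.\<close>

lemma finite_closed_set:
  assumes S: "\<And>n. finite (S n) \<and> B n \<subseteq> S n \<and> S n \<subseteq> H n \<and> (\<forall>u\<in>S n. \<forall>v\<in>S n. joined G (S n) u v)"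
    and T: "\<And>v. v \<in> U \<Longrightarrow> targets (block v) (T (block v))"
  shows "\<exists>W. finite W \<and> W \<noteq> {} \<and> W \<subseteq> U \<and> (\<forall>v\<in>W. block v \<subseteq> W \<and> T (block v) \<subseteq> W)"
proof -
  \<comment> \<open>Every move is an edge of \<open>G\<close>, so an injective sequence of moves is
    a ray. Moves to targets start only at the vertex of the block that is actually adjacent to the
    target.\<close>
  define R where "R v w \<longleftrightarrow> {v, w} \<in> edges G \<and> ((\<exists>n. v \<in> S n \<and> w \<in> S n) \<or> v \<in> U \<and> w \<in> T (block v))" for v w
  obtain v0 where v0: "v0 \<in> U" using U_nonempty by blast
  have SH: "S n \<subseteq> H n" for n using S by blast
  have fin: "finite {w. R v w}" for v
  proof -
    have "finite {n. v \<in> S n}"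
    proof (cases "\<exists>n. v \<in> S n")
      case True
      then obtain n where "v \<in> S n" by blast
      then have "{n. v \<in> S n} \<subseteq> {n}" using H_unique SH by blast
      then show ?thesis by (rule finite_subset) simp
    qed simp
    then have "finite ((\<Union>n\<in>{n. v \<in> S n}. S n) \<union> (if v \<in> U then T (block v) else {}))"
      using S T by (auto simp: targets_def)
    then show ?thesis by (rule rev_finite_subset) (auto simp: R_def)
  qed
  have reachUS: "w \<in> U \<or> (\<exists>n. w \<in> S n)" if "R\<^sup>*\<^sup>* v0 w" for w
    using that
  proof (induction rule: rtranclp_induct)
    case base then show ?case using v0 by simp
  next
    case (step y z)
    then show ?case using T[of y] by (auto simp: R_def targets_def)
  qed
  let ?W' = "{w. R\<^sup>*\<^sup>* v0 w}"
  have finW: "finite ?W'"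
  proof (rule ccontr)
    assume "infinite ?W'"
    from koenig[OF fin this] obtain f :: "nat \<Rightarrow> 'a" where f: "inj f" "f 0 = v0" "\<forall>i. R (f i) (f (Suc i))"
      by blast
    have edge: "{f i, f (Suc i)} \<in> edges G" for i using f(3) by (simp add: R_def)
    then have "is_ray G f"
      using f(1) simple_graph_edgeD(1)[OF G(1)] by (auto simp: is_ray_def)
    then obtain j n where jn: "\<forall>i\<ge>n. f i \<in> H j - B j" using ray_in_pocket by blast
    have reach: "R\<^sup>*\<^sup>* v0 (f i)" for i
      by (induction i) (use f in \<open>auto intro: rtranclp.rtrancl_into_rtrancl\<close>)
    \<comment> \<open>Interior vertices are outside \<open>U\<close>, so they can be reached only as
      members of a connector, here the finite one of pocket \<open>j\<close>.\<close>
    have "f i \<in> S j" if "i \<ge> n" for i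
    proof -
      have fi: "f i \<in> H j" "f i \<notin> B j" using jn that by auto
      then have "f i \<notin> U" by (auto simp: U_def)
      then obtain l where "f i \<in> S l" using reachUS[OF reach] by blast
      then show ?thesis using H_unique[of "f i" j l] SH[of l] fi(1) by blast
    qed
    then have "f ` {n..} \<subseteq> S j" by auto
    moreover have "finite (S j)" using S[of j] by simp
    ultimately have "finite (f ` {n..})" by (rule finite_subset)
    then show False using f(1) by (simp add: finite_image_iff inj_on_subset infinite_Ici)
  qed
  let ?W = "?W' \<inter> U"
  have closed: "block v \<subseteq> ?W" if v: "v \<in> ?W" for v
  proof (cases v rule: block_cases)
    case (1 n)
    have "w \<in> ?W'" if "w \<in> S n" for w
    proof (rule joined_closed)
      show "joined G (S n) v w" using S[of n] 1(1) that by blast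
      show "v \<in> ?W'" using v by simp
      show "y \<in> ?W'" if "x \<in> ?W'" "x \<in> S n" "y \<in> S n" "{x, y} \<in> edges G" for x y
      proof -
        have "R x y" using that by (auto simp: R_def)
        then show ?thesis using that(1) by (auto intro: rtranclp.rtrancl_into_rtrancl)
      qed
    qed
    then show ?thesis using S[of n] BU[of n] 1(2) by blast
  next
    case 2 then show ?thesis using v by simp
  qed
  moreover have "T (block v) \<subseteq> ?W" if v: "v \<in> ?W" for v
  proof
    fix w assume w: "w \<in> T (block v)"
    have t: "targets (block v) (T (block v))" using T v by simp
    then obtain u where u: "u \<in> block v" "{u, w} \<in> edges G" using w by (auto simp: targets_def)
    have "u \<in> ?W" using closed[OF v] u(1) by blast
    \<comment> \<open>The vertex adjacent to \<open>w\<close> may differ from \<open>v\<close>, but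
      it has the same block and hence the same targets.\<close>
    then have "R u w" using u w block_eq[OF u(1)] by (simp add: R_def)
    then have "w \<in> ?W'" using \<open>u \<in> ?W\<close> by (auto intro: rtranclp.rtrancl_into_rtrancl)
    moreover have "w \<in> U" using t w by (auto simp: targets_def)
    ultimately show "w \<in> ?W" by blast
  qed
  moreover have "v0 \<in> ?W" using v0 by simp
  ultimately show ?thesis using finW by (intro exI[of _ ?W]) blast
qed

text \<open>A closed set \<open>W\<close> is a disjoint union of blocks each sending its edges into
  \<open>W\<close>, so the bounds for the blocks add up.\<close>

lemma finite_dense_set:
  "\<exists>W. finite W \<and> W \<noteq> {} \<and> W \<subseteq> verts G \<and> m * real (card W) \<le> real (\<Sum>v\<in>W. card (nbrs G v \<inter> W))"
proof -
  have "\<exists>S. finite S \<and> B n \<subseteq> S \<and> S \<subseteq> H n \<and> (\<forall>u\<in>S. \<forall>v\<in>S. joined G S u v)" for n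
    by (rule finite_connector[OF HV BH finB]) (use pocket in \<open>auto simp: pocket_def\<close>)
  then have "\<forall>n. \<exists>S. finite S \<and> B n \<subseteq> S \<and> S \<subseteq> H n \<and> (\<forall>u\<in>S. \<forall>v\<in>S. joined G S u v)" by (rule allI)
  then obtain S where S: "\<forall>n. finite (S n) \<and> B n \<subseteq> S n \<and> S n \<subseteq> H n \<and> (\<forall>u\<in>S n. \<forall>v\<in>S n. joined G (S n) u v)"
    by (elim choice[THEN exE])
  \<comment> \<open>Targets are chosen per block and not per vertex, so that all vertices of a block
    share them.\<close>
  have "\<forall>b\<in>block ` U. \<exists>T. targets b T" using targets_exist by (intro ballI) auto
  then obtain T where T: "\<forall>b\<in>block ` U. targets b (T b)" by (elim bchoice[THEN exE])
  have T': "targets (block v) (T (block v))" if "v \<in> U" for v using T that by (rule bspec[OF _ imageI])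
  from finite_closed_set[OF spec[OF S] T'] obtain W where W: "finite W" "W \<noteq> {}" "W \<subseteq> U"
    "\<forall>v\<in>W. block v \<subseteq> W \<and> T (block v) \<subseteq> W" by blast
  let ?g = "\<lambda>v. card (nbrs G v \<inter> W)"
  have fib: "{x \<in> W. block x = b} = b" if "b \<in> block ` W" for b
  proof -
    obtain v where v: "v \<in> W" "b = block v" using \<open>b \<in> block ` W\<close> by blast
    show ?thesis
    proof (intro equalityI subsetI)
      fix x assume "x \<in> {x \<in> W. block x = b}"
      then show "x \<in> b" using block_self by auto
    next
      fix x assume "x \<in> b"
      then show "x \<in> {x \<in> W. block x = b}" using v W(4) block_eq[of x v] by auto
    qed
  qed
  have le: "m * real (card b) \<le> real (\<Sum>v\<in>b. ?g v)" if "b \<in> block ` W" for b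
  proof -
    obtain v where v: "v \<in> W" "b = block v" using \<open>b \<in> block ` W\<close> by blast
    have "m * real (card b) \<le> real (\<Sum>u\<in>b. card (nbrs G u \<inter> T b))"
      using T' W(3) v by (auto simp: targets_def)
    also have "(\<Sum>u\<in>b. card (nbrs G u \<inter> T b)) \<le> (\<Sum>v\<in>b. ?g v)"
      using v W(1,4) by (intro sum_mono card_mono) auto
    finally show ?thesis by simp
  qed
  have "m * real (card W) = (\<Sum>v\<in>W. m)" by simp
  also have "\<dots> = (\<Sum>b\<in>block ` W. \<Sum>v\<in>{x \<in> W. block x = b}. m)" using W(1) by (rule sum.image_gen)
  also have "\<dots> = (\<Sum>b\<in>block ` W. m * real (card b))"
    by (rule sum.cong[OF refl]) (simp add: fib)
  also have "\<dots> \<le> (\<Sum>b\<in>block ` W. real (\<Sum>v\<in>b. ?g v))" using le by (rule sum_mono)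
  also have "\<dots> = real (\<Sum>b\<in>block ` W. \<Sum>v\<in>b. ?g v)" by simp
  also have "(\<Sum>b\<in>block ` W. \<Sum>v\<in>b. ?g v) = (\<Sum>b\<in>block ` W. \<Sum>v\<in>{x \<in> W. block x = b}. ?g v)"
    by (rule sum.cong[OF refl]) (simp only: fib)
  also have "\<dots> = (\<Sum>v\<in>W. ?g v)" using sum.image_gen[OF W(1), of ?g block] by simp
  finally show ?thesis using W UV by (intro exI[of _ W]) auto
qed

end

subsection \<open>Relabelling\<close>

lemma joined_image:
  assumes "joined K A u v" "\<And>x y. {x, y} \<in> edges K \<Longrightarrow> {g x, g y} \<in> edges F"
  shows "joined F (g ` A) (g u) (g v)"
proof -
  have "(\<lambda>x y. {x, y} \<in> edges K \<and> x \<in> A \<and> y \<in> A)\<^sup>*\<^sup>* u v" "u \<in> A"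
    using assms by (auto simp: joined_def)
  then show ?thesis
  proof (induction rule: rtranclp_induct)
    case base then show ?case by (simp add: joined_refl)
  next
    case (step y z)
    then show ?case using assms(2)[of y z] joined_step[of F "g ` A" "g u" "g y" "g z"] by simp
  qed
qed

lemma is_minor_embed:
  assumes minor: "is_minor X K" and K: "simple_graph K"
    and g: "inj_on g (verts K)" "g ` verts K \<subseteq> verts F"
    and edge: "\<And>x y. {x, y} \<in> edges K \<Longrightarrow> {g x, g y} \<in> edges F"
  shows "is_minor X F"
proof -
  obtain B where B: "\<forall>x\<in>verts X. B x \<subseteq> verts K \<and> connected_graph (induced K (B x))"
    and disj: "\<forall>x\<in>verts X. \<forall>y\<in>verts X. x \<noteq> y \<longrightarrow> B x \<inter> B y = {}"
    and adj: "\<forall>x y. {x, y} \<in> edges X \<longrightarrow> (\<exists>u\<in>B x. \<exists>v\<in>B y. {u, v} \<in> edges K)"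
    using minor unfolding is_minor_def by (elim exE conjE)
  show ?thesis unfolding is_minor_def
  proof (intro exI[of _ "\<lambda>x. g ` B x"] conjI ballI allI impI)
    fix x assume x: "x \<in> verts X"
    then have Bx: "B x \<subseteq> verts K" "B x \<noteq> {}" "\<forall>u\<in>B x. \<forall>v\<in>B x. joined K (B x) u v"
      using B connected_induced_iff[of "B x" K] by auto
    show gB: "g ` B x \<subseteq> verts F" using Bx(1) g(2) by auto
    show "connected_graph (induced F (g ` B x))"
      unfolding connected_induced_iff[OF gB] using Bx(2,3) edge by (auto intro!: joined_image)
  next
    fix x y assume xy: "x \<in> verts X" "y \<in> verts X" "x \<noteq> y"
    then have "B x \<inter> B y = {}" "B x \<subseteq> verts K" "B y \<subseteq> verts K" using B disj by auto
    then show "g ` B x \<inter> g ` B y = {}" using inj_on_image_Int[OF g(1), of "B x" "B y"] by simp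
  next
    fix x y assume "{x, y} \<in> edges X"
    then obtain u v where "u \<in> B x" "v \<in> B y" "{u, v} \<in> edges K" using adj by blast
    then show "\<exists>u\<in>g ` B x. \<exists>v\<in>g ` B y. {u, v} \<in> edges F" using edge[of u v] by auto
  qed
qed

lemma path_edges_image: "path_edges p = (\<lambda>i. {p ! i, p ! Suc i}) ` {i. Suc i < length p}"
  by (auto simp: path_edges_def)

lemma path_edges_map: "path_edges (map g p) = (`) g ` path_edges p"
  by (simp add: path_edges_image image_image cong: image_cong_simp)

lemma inner_verts_map:
  assumes "inj_on g (set p)" "p \<noteq> []" shows "inner_verts (map g p) = g ` inner_verts p"
proof -
  have "g ` (set p - {hd p, last p}) = g ` set p - g ` {hd p, last p}"
    using assms by (intro inj_on_image_set_diff[of g "set p"]) auto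
  then show ?thesis using assms(2) by (simp add: inner_verts_def hd_map last_map)
qed

text \<open>The whole subdivision is mapped along \<open>g\<close>; injectivity keeps paths simple
  and their interiors disjoint.\<close>

lemma is_top_minor_embed:
  assumes minor: "is_top_minor T K"
    and g: "inj_on g (verts K)" "g ` verts K \<subseteq> verts F"
    and edge: "\<And>x y. {x, y} \<in> edges K \<Longrightarrow> {g x, g y} \<in> edges F"
  shows "is_top_minor T F"
proof -
  obtain X where X: "subgraph X K" "is_subdivision X T" using minor by (auto simp: is_top_minor_def)
  obtain f P where f: "inj_on f (verts T)"
    and P: "\<forall>e\<in>edges T. is_path X (P e) \<and> {hd (P e), last (P e)} = f ` e
          \<and> inner_verts (P e) \<inter> f ` verts T = {}"
    and disj: "\<forall>e\<in>edges T. \<forall>e'\<in>edges T. e \<noteq> e' \<longrightarrow> inner_verts (P e) \<inter> inner_verts (P e') = {}"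
    and vX: "verts X = f ` verts T \<union> (\<Union>e\<in>edges T. set (P e))"
    and eX: "edges X = (\<Union>e\<in>edges T. path_edges (P e))"
    using X(2) unfolding is_subdivision_def by (elim exE conjE)
  have XK: "verts X \<subseteq> verts K" "edges X \<subseteq> edges K" "simple_graph X" using X(1) by (auto simp: subgraph_def)
  have gX: "inj_on g (verts X)" using g(1) XK(1) by (rule inj_on_subset)
  define X' where "X' = Graph (g ` verts X) ((`) g ` edges X)"
  have simp_X': "simple_graph X'" unfolding simple_graph_def
  proof
    fix e assume "e \<in> edges X'"
    then obtain e0 where e0: "e0 \<in> edges X" "e = g ` e0" by (auto simp: X'_def)
    then obtain u v where uv: "u \<in> verts X" "v \<in> verts X" "u \<noteq> v" "e0 = {u, v}"
      using simple_graph_edge_cases[OF XK(3)] by blast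
    then have "g u \<noteq> g v" using gX by (auto simp: inj_on_def)
    then show "\<exists>u v. u \<in> verts X' \<and> v \<in> verts X' \<and> u \<noteq> v \<and> e = {u, v}"
      using uv e0(2) by (intro exI[of _ "g u"] exI[of _ "g v"]) (auto simp: X'_def)
  qed
  have "e \<in> edges F" if eX': "e \<in> edges X'" for e
  proof -
    obtain e0 where e0: "e0 \<in> edges X" "e = g ` e0" using eX' by (auto simp: X'_def)
    then obtain u v where "e0 = {u, v}" using simple_graph_edge_cases[OF XK(3)] by blast
    then show ?thesis using edge[of u v] e0 XK(2) by auto
  qed
  then have sub: "subgraph X' F"
  proof -
    have "verts X' \<subseteq> verts F" using g(2) XK(1) by (auto simp: X'_def)
    then show ?thesis using simp_X' \<open>\<And>e. e \<in> edges X' \<Longrightarrow> e \<in> edges F\<close> by (auto simp: subgraph_def)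
  qed
  have Pp: "is_path X (P e)" "P e \<noteq> []" "set (P e) \<subseteq> verts X" if "e \<in> edges T" for e
    using P that by (auto simp: is_path_def)
  have inn: "inner_verts (map g (P e)) = g ` inner_verts (P e)" if "e \<in> edges T" for e
    using inner_verts_map[of g "P e"] Pp[OF that] inj_on_subset[OF gX] by blast
  have innX: "inner_verts (P e) \<subseteq> verts X" if "e \<in> edges T" for e
    using Pp(3)[OF that] by (auto simp: inner_verts_def)
  have fX: "f ` verts T \<subseteq> verts X" using vX by blast
  have gint: "g ` A \<inter> g ` B = {}" if "A \<inter> B = {}" "A \<subseteq> verts X" "B \<subseteq> verts X" for A B
    using inj_on_image_Int[OF gX that(2,3)] that(1) by simp
  have "is_subdivision X' T"
    unfolding is_subdivision_def
  proof (intro exI[of _ "g \<circ> f"] exI[of _ "\<lambda>e. map g (P e)"] conjI ballI impI)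
    show "inj_on (g \<circ> f) (verts T)" using f inj_on_subset[OF gX fX] by (rule comp_inj_on)
    show "verts X' = (g \<circ> f) ` verts T \<union> (\<Union>e\<in>edges T. set (map g (P e)))"
      by (simp add: X'_def vX image_Un image_UN image_comp)
    show "edges X' = (\<Union>e\<in>edges T. path_edges (map g (P e)))"
      by (simp add: X'_def eX path_edges_map image_UN)
  next
    fix e assume e: "e \<in> edges T"
    have "successively (\<lambda>x y. {x, y} \<in> edges X) (P e)" using Pp(1)[OF e] by (simp add: is_path_def)
    then have "successively (\<lambda>x y. {g x, g y} \<in> edges X') (P e)"
    proof (rule successively_mono)
      fix x y assume "{x, y} \<in> edges X"
      then have "g ` {x, y} \<in> edges X'" unfolding X'_def graph.sel by (rule imageI)
      then show "{g x, g y} \<in> edges X'" by simp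
    qed
    moreover have "inj_on g (set (P e))" using gX Pp(3)[OF e] by (rule inj_on_subset)
    moreover have "g ` set (P e) \<subseteq> verts X'" using Pp(3)[OF e] by (auto simp: X'_def)
    ultimately show "is_path X' (map g (P e))"
      using Pp(1)[OF e] by (simp add: is_path_def distinct_map successively_map)
    show "{hd (map g (P e)), last (map g (P e))} = (g \<circ> f) ` e"
    proof -
      have "{hd (P e), last (P e)} = f ` e" using P e by blast
      from arg_cong[OF this, of "(`) g"] have "g ` f ` e = {g (hd (P e)), g (last (P e))}" by simp
      then show ?thesis using Pp(2)[OF e] by (simp add: hd_map last_map image_comp)
    qed
    have "inner_verts (P e) \<inter> f ` verts T = {}" using P e by blast
    then show "inner_verts (map g (P e)) \<inter> (g \<circ> f) ` verts T = {}"
      unfolding inn[OF e] image_comp[symmetric] by (rule gint[OF _ innX[OF e] fX])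
    fix e' assume e': "e' \<in> edges T" "e \<noteq> e'"
    have "inner_verts (P e) \<inter> inner_verts (P e') = {}" using disj e e' by simp
    then show "inner_verts (map g (P e)) \<inter> inner_verts (map g (P e')) = {}"
      unfolding inn[OF e] inn[OF e'(1)] by (rule gint[OF _ innX[OF e] innX[OF e'(1)]])
  qed
  then show ?thesis using sub by (auto simp: is_top_minor_def)
qed

text \<open>The hypotheses on the constants speak of graphs on \<open>nat\<close>. The finite
  subgraph is copied there, and the minor found in the copy is carried back along
  \<open>g\<close>.\<close>

lemma nat_copy:
  assumes F: "simple_graph F" "finite (verts F)" "verts F \<noteq> {}"
  shows "\<exists>(K :: nat graph) g. simple_graph K \<and> finite (verts K) \<and> verts K \<noteq> {} \<and> avg_degree K = avg_degree F
    \<and> inj_on g (verts K) \<and> g ` verts K \<subseteq> verts F \<and> (\<forall>x y. {x, y} \<in> edges K \<longrightarrow> {g x, g y} \<in> edges F)"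
proof -
  obtain h :: "'a \<Rightarrow> nat" where h: "inj_on h (verts F)"
    using finite_imp_inj_to_nat_seg[OF F(2)] by blast
  define K where "K = Graph (h ` verts F) ((`) h ` edges F)"
  define g where "g = inv_into (verts F) h"
  have gh: "g (h v) = v" if "v \<in> verts F" for v using h that by (simp add: g_def)
  have eK: "{h u, h v} \<in> edges K \<longleftrightarrow> {u, v} \<in> edges F" if "u \<in> verts F" "v \<in> verts F" for u v
  proof
    assume "{h u, h v} \<in> edges K"
    then obtain e where e: "e \<in> edges F" "h ` e = h ` {u, v}" by (auto simp: K_def)
    then have "e \<subseteq> verts F" using F(1) by (auto simp: simple_graph_def)
    then have "e = {u, v}" using e(2) that inj_on_image_eq_iff[OF h, of e "{u, v}"] by simp
    then show "{u, v} \<in> edges F" using e by simp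
  next
    assume "{u, v} \<in> edges F"
    then have "h ` {u, v} \<in> edges K" unfolding K_def graph.sel by (rule imageI)
    then show "{h u, h v} \<in> edges K" by simp
  qed
  have nK: "nbrs K (h v) = h ` nbrs F v" if v: "v \<in> verts F" for v
    using eK[OF v] by (auto simp: nbrs_def K_def)
  have sK: "simple_graph K" unfolding simple_graph_def
  proof
    fix e assume "e \<in> edges K"
    then obtain e0 where e0: "e0 \<in> edges F" "e = h ` e0" by (auto simp: K_def)
    then obtain u v where uv: "u \<in> verts F" "v \<in> verts F" "u \<noteq> v" "e0 = {u, v}"
      using simple_graph_edge_cases[OF F(1)] by blast
    then have "h u \<noteq> h v" using h by (auto simp: inj_on_def)
    then show "\<exists>u v. u \<in> verts K \<and> v \<in> verts K \<and> u \<noteq> v \<and> e = {u, v}"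
      using uv e0(2) by (intro exI[of _ "h u"] exI[of _ "h v"]) (auto simp: K_def)
  qed
  have avg: "avg_degree K = avg_degree F"
  proof -
    have "card (nbrs K (h v)) = card (nbrs F v)" if "v \<in> verts F" for v
      unfolding nK[OF that] using inj_on_subset[OF h] by (intro card_image) (auto simp: nbrs_def)
    then have "(\<Sum>v\<in>verts K. real (card (nbrs K v))) = (\<Sum>v\<in>verts F. real (card (nbrs F v)))"
      using h by (simp add: K_def sum.reindex)
    moreover have "card (verts K) = card (verts F)" using h by (simp add: K_def card_image)
    ultimately show ?thesis by (simp add: avg_degree_def)
  qed
  have edge: "{g x, g y} \<in> edges F" if "{x, y} \<in> edges K" for x y
  proof -
    have "x \<in> verts K" "y \<in> verts K" using simple_graph_edgeD[OF sK that] by auto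
    then obtain u v where "u \<in> verts F" "v \<in> verts F" "x = h u" "y = h v" by (auto simp: K_def)
    then show ?thesis using that eK gh by simp
  qed
  have gK: "inj_on g (verts K)" "g ` verts K \<subseteq> verts F"
    using gh by (auto simp: K_def inj_on_def)
  have "finite (verts K)" "verts K \<noteq> {}" using F by (simp_all add: K_def)
  then show ?thesis
    by (intro exI[of _ K] exI[of _ g] conjI allI impI sK avg gK edge)
qed

subsection \<open>Countably many ends\<close>

text \<open>Common core of both parts, with \<open>m\<close> the average degree that forces the
  minor or the subdivision.\<close>

lemma dominated_or_dense:
  assumes G: "simple_graph G" "verts G \<noteq> {}" and ends: "countable (ends G)"
    and deg: "ereal (m + real k) \<le> min_degree_VE G"
  shows "(\<exists>F. subgraph F G \<and> finite (verts F) \<and> is_top_minor (complete_graph k) F)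
    \<or> (\<exists>F. subgraph F G \<and> finite (verts F) \<and> verts F \<noteq> {} \<and> m \<le> avg_degree F)"
proof (cases "\<exists>\<omega>\<in>ends G. infinite (Dom G \<omega>) \<or> k \<le> card (Dom G \<omega>)")
  case True then show ?thesis using top_minor_of_Dom[OF G(1)] by blast
next
  case False
  then have D: "finite (Dom G \<omega>)" "card (Dom G \<omega>) < k" if "\<omega> \<in> ends G" for \<omega>
    using that by auto
  have degv: "ereal (m + real k) \<le> deg G v" if "v \<in> verts G" for v
    using deg that unfolding min_degree_VE_def by (meson Inf_lower UnI1 image_eqI order_trans)
  have dege: "ereal (m + real k) \<le> rel_degree G \<omega>" if "\<omega> \<in> ends G" for \<omega>
    using deg that unfolding min_degree_VE_def by (meson Inf_lower UnI2 image_eqI order_trans)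
  have T: "\<exists>T. finite T \<and> T \<subseteq> nbrs G v \<and> m \<le> real (card T)" if v: "v \<in> verts G" for v
  proof (cases "finite (nbrs G v)")
    case True
    then have "m + real k \<le> real (card (nbrs G v))" using degv[OF v] by (simp add: deg_def ecard_def)
    then show ?thesis using True by (intro exI[of _ "nbrs G v"]) simp
  next
    case False
    obtain n :: nat where "m \<le> real n" using real_arch_simple by blast
    then show ?thesis using infinite_arbitrarily_large[OF False, of n] by auto
  qed
  have ratio: "\<exists>h b. h \<inter> Y = {} \<and> ratio_pocket G m \<omega> h b (Dom G \<omega>)" if \<omega>: "\<omega> \<in> ends G" and Y: "finite Y" for \<omega> Y
  proof (rule ratio_region[OF G(1) \<omega> D(1)[OF \<omega>] dege[OF \<omega>] _ Y])
    show "m + real (card (Dom G \<omega>)) < m + real k" using D(2)[OF \<omega>] by simp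
  qed
  obtain e :: "nat \<Rightarrow> (nat \<Rightarrow> 'a) set" where e: "\<And>\<omega>. \<omega> \<in> ends G \<Longrightarrow> \<exists>n. e n = \<omega>"
    using from_nat_into_surj[OF ends] by blast
  define M where "M = nat \<lceil>m\<rceil>"
  have M: "m \<le> real M" unfolding M_def by (rule real_nat_ceiling_ge)
  obtain H B D' Q where st: "\<forall>n. stage G m M e H B D' Q n (H n) (B n) (D' n) (Q n)"
    using stages_exist[OF G(1) D(1) ratio] by blast
  interpret pocket_system G m M e H B D' Q
    by unfold_locales (use G st e T M in auto)
  obtain W where W: "finite W" "W \<noteq> {}" "W \<subseteq> verts G"
    "m * real (card W) \<le> real (\<Sum>v\<in>W. card (nbrs G v \<inter> W))"
    using finite_dense_set by blast
  define F where "F = induced G W"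
  have vF: "verts F = W" using W(3) by (auto simp: F_def)
  have "nbrs F v = nbrs G v \<inter> W" if "v \<in> W" for v
    using that W(3) by (auto simp: nbrs_def F_def)
  then have "(\<Sum>v\<in>W. card (nbrs G v \<inter> W)) = (\<Sum>v\<in>verts F. card (nbrs F v))" by (simp add: vF)
  then have "m \<le> avg_degree F"
    using W(1,2,4) by (simp add: avg_degree_def vF pos_le_divide_eq card_gt_0_iff)
  moreover have "subgraph F G" unfolding F_def by (rule subgraph_induced[OF G(1)])
  ultimately show ?thesis using vF W(1,2) by blast
qed

theorem theorem4:
  fixes c1 c2 :: real and k :: nat and G :: "'a graph"
  assumes c1: "\<forall>(j::nat) (H::nat graph). simple_graph H \<and> finite (verts H) \<and> verts H \<noteq> {}
      \<and> avg_degree H \<ge> c1 * real j * sqrt (ln (real j)) \<longrightarrow> is_minor (complete_graph j) H"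
    and c2: "\<forall>(j::nat) (H::nat graph). simple_graph H \<and> finite (verts H) \<and> verts H \<noteq> {}
      \<and> avg_degree H \<ge> c2 * (real j)^2 \<longrightarrow> is_top_minor (complete_graph j) H"
    and G: "simple_graph G" "verts G \<noteq> {}"
    and countable_ends: "countable (ends G)"
  shows "(min_degree_VE G \<ge> ereal (c1 * real k * sqrt (ln (real k)) + real k)
            \<longrightarrow> minor_le (complete_graph k) G)
       \<and> (min_degree_VE G \<ge> ereal (c2 * (real k)^2 + real k)
            \<longrightarrow> top_minor_le (complete_graph k) G)"
proof (intro conjI impI)
  assume "min_degree_VE G \<ge> ereal (c1 * real k * sqrt (ln (real k)) + real k)"
  from dominated_or_dense[OF G countable_ends this] show "minor_le (complete_graph k) G"
  proof
    assume "\<exists>F. subgraph F G \<and> finite (verts F) \<and> is_top_minor (complete_graph k) F"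
    \<comment> \<open>Domination yields a subdivision, which is contracted to the required
      minor.\<close>
    then show ?thesis using top_minor_imp_minor_complete unfolding minor_le_def by blast
  next
    assume "\<exists>F. subgraph F G \<and> finite (verts F) \<and> verts F \<noteq> {} \<and> c1 * real k * sqrt (ln (real k)) \<le> avg_degree F"
    then obtain F where F: "subgraph F G" "finite (verts F)" "verts F \<noteq> {}"
      "c1 * real k * sqrt (ln (real k)) \<le> avg_degree F" by blast
    have sF: "simple_graph F" using F(1) by (simp add: subgraph_def)
    obtain K :: "nat graph" and g where K: "simple_graph K" "finite (verts K)" "verts K \<noteq> {}"
      "avg_degree K = avg_degree F" and g: "inj_on g (verts K)" "g ` verts K \<subseteq> verts F"
      "\<forall>x y. {x, y} \<in> edges K \<longrightarrow> {g x, g y} \<in> edges F"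
      using nat_copy[OF sF F(2,3)] by (elim exE conjE)
    have "is_minor (complete_graph k) K" using c1 K F(4) by simp
    then have "is_minor (complete_graph k) F" by (rule is_minor_embed[OF _ K(1) g(1,2)]) (use g(3) in simp)
    then show ?thesis using F(1,2) unfolding minor_le_def by blast
  qed
next
  assume "min_degree_VE G \<ge> ereal (c2 * (real k)^2 + real k)"
  from dominated_or_dense[OF G countable_ends this] show "top_minor_le (complete_graph k) G"
  proof
    assume "\<exists>F. subgraph F G \<and> finite (verts F) \<and> is_top_minor (complete_graph k) F"
    then show ?thesis unfolding top_minor_le_def by blast
  next
    assume "\<exists>F. subgraph F G \<and> finite (verts F) \<and> verts F \<noteq> {} \<and> c2 * (real k)^2 \<le> avg_degree F"
    then obtain F where F: "subgraph F G" "finite (verts F)" "verts F \<noteq> {}"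
      "c2 * (real k)^2 \<le> avg_degree F" by blast
    have sF: "simple_graph F" using F(1) by (simp add: subgraph_def)
    obtain K :: "nat graph" and g where K: "simple_graph K" "finite (verts K)" "verts K \<noteq> {}"
      "avg_degree K = avg_degree F" and g: "inj_on g (verts K)" "g ` verts K \<subseteq> verts F"
      "\<forall>x y. {x, y} \<in> edges K \<longrightarrow> {g x, g y} \<in> edges F"
      using nat_copy[OF sF F(2,3)] by (elim exE conjE)
    have "is_top_minor (complete_graph k) K" using c2 K F(4) by simp
    then have "is_top_minor (complete_graph k) F" by (rule is_top_minor_embed[OF _ g(1,2)]) (use g(3) in simp)
    then show ?thesis using F(1,2) unfolding top_minor_le_def by blast
  qed
qed

end
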